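(* A random field on $\mathbb{Z}^\nu$ (with finite state space $\mathcal{X}$) is a Gibbs random field if and only if it is strictly positive and its one-point finite-conditional distribution $\{q_t^{\tilde x} : t\in\mathbb{Z}^\nu,\ \tilde x\in\widetilde{\mathcal{X}^t}\}$ satisfies one of the following equivalent conditions: (A) the limits $$\lim_{\Lambda\uparrow\mathbb{Z}^\nu\setminus t} q_t^{\bar x_\Lambda}(x),\qquad t\in\mathbb{Z}^\nu,\ x\in\mathcal{X}^t,\ \bar x\in\mathcal{X}^{t^c},$$ exist, are nonnull uniformly with respect to $\bar x$, and the convergence is uniform with respect to $\bar x$; (B) the limits $$\lim_{\Lambda\uparrow\mathbb{Z}^\nu\setminus t} q_t^{\bar x_\Lambda}(x),\qquad t\in\mathbb{Z}^\nu,\ x\in\mathcal{X}^t,\ \bar x\in\mathcal{X}^{t^c},$$ exist, are strictly positive, and the convergence is uniform with respect to $\bar x$.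
   Context: Setting. $\mathbb{Z}^\nu$ is the $\nu$-dimensional integer lattice and $\mathcal{X}$ is a finite set with the discrete topology and the $\sigma$-algebra of all subsets. For $S\subset\mathbb{Z}^\nu$: $S^c=\mathbb{Z}^\nu\setminus S$; $\mathcal{E}(S)$ is the set of all finite subsets of $S$, $\mathcal{E}^*(S)=\mathcal{E}(S)\setminus\{\emptyset\}$, and $\mathcal{E}=\mathcal{E}(\mathbb{Z}^\nu)$. One-point sets $\{t\}$ are written $t$. $\mathcal{X}^S$ is the space of configurations on $S$; $\mathcal{X}^\emptyset$ consists of the empty configuration only. For $T\subset S$ and $x\in\mathcal{X}^S$, $x_T$ is the restriction of $x$ to $T$; for disjoint $T,S$ and $x\in\mathcal{X}^T$, $y\in\mathcal{X}^S$, $xy\in\mathcal{X}^{T\cup S}$ is the concatenation. The support $\mathfrak{S}(x)$ of $x\in\mathcal{X}^S$ is $S$. For $\Lambda\in\mathcal{E}$, $\widetilde{\mathcal{X}^\Lambda}=\bigcup_{\tilde\Lambda\in\mathcal{E}^*(\Lambda^c)}\mathcal{X}^{\tilde\Lambda}$ is the space of configurations with non-empty finite support contained in $\Lambda^c$. Throughout, $\lim_{\Lambda\uparrow S}$ denotes the limit as the finite set $\Lambda\subset S$ increases to $S$. "Uniform with respect to $\bar x$" is meant for each fixed $t$ and $x$. A random field is a probability measure $\mathbf{P}$ on $\mathcal{X}^{\mathbb{Z}^\nu}$ (product $\sigma$-algebra); $\mathbf{P}_S$ is its marginal on $\mathcal{X}^S$. $\mathbf{P}$ is strictly positive if $\mathbf{P}_\Lambda(x)>0$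 for all $\Lambda\in\mathcal{E}$, $x\in\mathcal{X}^\Lambda$. For $\Lambda\in\mathcal{E}$ put $$q_\Lambda^{\tilde x}(x)=\frac{\mathbf{P}_{\Lambda\cup\mathfrak{S}(\tilde x)}(x\tilde x)}{\mathbf{P}_{\mathfrak{S}(\tilde x)}(\tilde x)},\qquad x\in\mathcal{X}^\Lambda,\ \tilde x\in\widetilde{\mathcal{X}^\Lambda},$$ whenever the denominator is nonzero. For a strictly positive random field, the system $\{q_t^{\tilde x}: t\in\mathbb{Z}^\nu,\ \tilde x\in\widetilde{\mathcal{X}^t}\}$ is its (uniquely determined) one-point finite-conditional distribution. Conditional distributions. For $\Lambda\in\mathcal{E}$ the limits $q_\Lambda^{\bar x}(x)=\lim_{\tilde\Lambda\uparrow\mathbb{Z}^\nu\setminus\Lambda}q_\Lambda^{\bar x_{\tilde\Lambda}}(x)$, $x\in\mathcal{X}^\Lambda$, exist for $\mathbf{P}_{\Lambda^c}$-almost all $\bar x\in\mathcal{X}^{\Lambda^c}$. A system $\{\mathbf{Q}_\Lambda^{\bar x}: \Lambda\in\mathcal{E},\ \bar x\in\mathcal{X}^{\Lambda^c}\}$ of probability distributions on $\mathcal{X}^\Lambda$ is a version of the conditional distribution of $\mathbf{P}$ if for every $\Lambda\in\mathcal{E}$ one has $\mathbf{Q}_\Lambda^{\bar x}=q_\Lambda^{\bar x}$ for $\mathbf{P}_{\Lambda^c}$-almost all $\bar x$. Gibbs random fields. A potential is a function $\Phi:\bigcup_{J\in\mathcal{E}^*(\mathbb{Z}^\nu)}\mathcal{X}^J\to\mathbb{R}\cup\{+\infty\}$.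 It is convergent if it is real-valued and the series $\sum_{\tilde J\in\mathcal{E}(t^c)}\Phi(x\bar x_{\tilde J})$ converge for all $t\in\mathbb{Z}^\nu$, $x\in\mathcal{X}^t$, $\bar x\in\mathcal{X}^{t^c}$; it is uniformly convergent if moreover this convergence is uniform with respect to $\bar x$. The Gibbsian specification with potential $\Phi$ is given by $$\mathbf{Q}_\Lambda^{\bar x}(x)=\frac{\exp(-U_\Lambda^{\bar x}(x))}{\sum_{y\in\mathcal{X}^\Lambda}\exp(-U_\Lambda^{\bar x}(y))},\qquad U_\Lambda^{\bar x}(x)=\sum_{\emptyset\ne J\subset\Lambda}\ \sum_{\tilde J\in\mathcal{E}(\Lambda^c)}\Phi(x_J\bar x_{\tilde J}),$$ for $\Lambda\in\mathcal{E}$, $x\in\mathcal{X}^\Lambda$, $\bar x\in\mathcal{X}^{\Lambda^c}$. A Gibbs random field is a random field which has, for some uniformly convergent potential $\Phi$, the Gibbsian specification with potential $\Phi$ as a version of its conditional distribution. *)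

theory Defs
  imports "HOL-Probability.Probability"
begin

text \<open>
  Sites are the points of the lattice, of dimension \<open>CARD('n)\<close>; the finite state space is the
  type \<open>'a\<close>.  A configuration on \<open>S\<close> is a function that is \<open>undefined\<close> outside \<open>S\<close>, as in the
  product measures of the library.  Since \<open>undefined\<close> is itself a state, the function does not
  determine its support, which is therefore passed as a separate argument where it matters.
  Restriction and concatenation of configurations are \<open>restrict\<close> and \<open>merge\<close>.
\<close>

type_synonym 'n site = "int ^ 'n"

definition fin_subsets :: "'n::finite site set \<Rightarrow> 'n site set set" where
  "fin_subsets S = {\<Lambda>. finite \<Lambda> \<and> \<Lambda> \<subseteq> S}"

definition conf :: "'n::finite site set \<Rightarrow> ('n site \<Rightarrow> 'a::finite) set" where
  "conf S = S \<rightarrow>\<^sub>E UNIV"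

definition conf_space :: "'n::finite site set \<Rightarrow> ('n site \<Rightarrow> 'a::finite) measure" where
  "conf_space S = PiM S (\<lambda>_. count_space UNIV)"


section \<open>Random fields and their finite-conditional distributions\<close>

definition random_field :: "('n::finite site \<Rightarrow> 'a::finite) measure \<Rightarrow> bool" where
  "random_field P \<longleftrightarrow> prob_space P \<and> sets P = sets (conf_space UNIV)"

definition marginal ::
  "('n::finite site \<Rightarrow> 'a::finite) measure \<Rightarrow> 'n site set \<Rightarrow> ('n site \<Rightarrow> 'a) measure" where
  "marginal P S = distr P (conf_space S) (\<lambda>\<omega>. restrict \<omega> S)"

definition strictly_positive :: "('n::finite site \<Rightarrow> 'a::finite) measure \<Rightarrow> bool" where
  "strictly_positive P \<longleftrightarrow>
     (\<forall>\<Lambda>\<in>fin_subsets UNIV. \<forall>x\<in>conf \<Lambda>. measure (marginal P \<Lambda>) {x} > 0)"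

text \<open>
  \<open>fin_cond P \<Lambda> \<Delta> y x\<close> is the conditional probability of \<open>x\<close> on \<open>\<Lambda>\<close> given \<open>y\<close> on \<open>\<Delta>\<close>.  It has
  the value 0 where the denominator vanishes.
\<close>

definition fin_cond ::
  "('n::finite site \<Rightarrow> 'a::finite) measure \<Rightarrow> 'n site set \<Rightarrow> 'n site set \<Rightarrow>
   ('n site \<Rightarrow> 'a) \<Rightarrow> ('n site \<Rightarrow> 'a) \<Rightarrow> real" where
  "fin_cond P \<Lambda> \<Delta> y x =
     measure (marginal P (\<Lambda> \<union> \<Delta>)) {merge \<Lambda> \<Delta> (x, y)} / measure (marginal P \<Delta>) {y}"


section \<open>Versions of the conditional distribution\<close>

text \<open>
  The limit over finite volumes increasing to \<open>S\<close> is the limit along \<open>finite_subsets_at_top S\<close>.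
  \<open>Q \<Lambda> z x\<close> stands for the probability of \<open>x\<close> on \<open>\<Lambda>\<close> under the boundary condition \<open>z\<close>.
\<close>

definition version_of_cond_distr ::
  "('n::finite site \<Rightarrow> 'a::finite) measure \<Rightarrow>
   ('n site set \<Rightarrow> ('n site \<Rightarrow> 'a) \<Rightarrow> ('n site \<Rightarrow> 'a) \<Rightarrow> real) \<Rightarrow> bool" where
  "version_of_cond_distr P Q \<longleftrightarrow>
     (\<forall>\<Lambda>\<in>fin_subsets UNIV.
        (\<forall>z\<in>conf (-\<Lambda>). (\<forall>x\<in>conf \<Lambda>. 0 \<le> Q \<Lambda> z x) \<and> (\<Sum>x\<in>conf \<Lambda>. Q \<Lambda> z x) = 1) \<and>
        (AE z in marginal P (-\<Lambda>). \<forall>x\<in>conf \<Lambda>.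
           ((\<lambda>\<Delta>. fin_cond P \<Lambda> \<Delta> (restrict z \<Delta>) x) \<longlongrightarrow> Q \<Lambda> z x) (finite_subsets_at_top (-\<Lambda>))))"


section \<open>Potentials and Gibbs random fields\<close>

type_synonym ('n, 'a) potential = "'n site set \<Rightarrow> ('n site \<Rightarrow> 'a) \<Rightarrow> ereal"

text \<open>
  The first argument of a potential is the support of the second one; only the values at
  non-empty finite supports matter.
\<close>

definition is_potential :: "('n::finite, 'a::finite) potential \<Rightarrow> bool" where
  "is_potential \<Phi> \<longleftrightarrow> (\<forall>J\<in>fin_subsets UNIV - {{}}. \<forall>x\<in>conf J. \<Phi> J x \<noteq> -\<infinity>)"

definition real_potential :: "('n::finite, 'a::finite) potential \<Rightarrow> bool" where
  "real_potential \<Phi> \<longleftrightarrow> (\<forall>J\<in>fin_subsets UNIV - {{}}. \<forall>x\<in>conf J. \<bar>\<Phi> J x\<bar> \<noteq> \<infinity>)"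

text \<open>
  The term of the energy for \<open>J\<close> inside and \<open>K\<close> outside the volume.  It is only used for
  real-valued potentials.
\<close>

definition interaction ::
  "('n::finite, 'a::finite) potential \<Rightarrow> 'n site set \<Rightarrow> 'n site set \<Rightarrow>
   ('n site \<Rightarrow> 'a) \<Rightarrow> ('n site \<Rightarrow> 'a) \<Rightarrow> real" where
  "interaction \<Phi> J K x z = real_of_ereal (\<Phi> (J \<union> K) (merge J K (restrict x J, restrict z K)))"

text \<open>
  The index set of the series carries no order, so convergence is that of unordered sums.
\<close>

definition convergent_potential :: "('n::finite, 'a::finite) potential \<Rightarrow> bool" where
  "convergent_potential \<Phi> \<longleftrightarrow> is_potential \<Phi> \<and> real_potential \<Phi> \<and>
     (\<forall>t. \<forall>x\<in>conf {t}. \<forall>z\<in>conf (-{t}).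
        (\<lambda>K. interaction \<Phi> {t} K x z) summable_on fin_subsets (-{t}))"

definition uniformly_convergent_potential :: "('n::finite, 'a::finite) potential \<Rightarrow> bool" where
  "uniformly_convergent_potential \<Phi> \<longleftrightarrow> convergent_potential \<Phi> \<and>
     (\<forall>t. \<forall>x\<in>conf {t}.
        uniform_limit (conf (-{t}))
          (\<lambda>F z. \<Sum>K\<in>F. interaction \<Phi> {t} K x z)
          (\<lambda>z. \<Sum>\<^sub>\<infinity>K\<in>fin_subsets (-{t}). interaction \<Phi> {t} K x z)
          (finite_subsets_at_top (fin_subsets (-{t}))))"

definition energy ::
  "('n::finite, 'a::finite) potential \<Rightarrow> 'n site set \<Rightarrow>
   ('n site \<Rightarrow> 'a) \<Rightarrow> ('n site \<Rightarrow> 'a) \<Rightarrow> real" where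
  "energy \<Phi> \<Lambda> z x = (\<Sum>J\<in>Pow \<Lambda> - {{}}. \<Sum>\<^sub>\<infinity>K\<in>fin_subsets (-\<Lambda>). interaction \<Phi> J K x z)"

definition gibbs_specification ::
  "('n::finite, 'a::finite) potential \<Rightarrow> 'n site set \<Rightarrow>
   ('n site \<Rightarrow> 'a) \<Rightarrow> ('n site \<Rightarrow> 'a) \<Rightarrow> real" where
  "gibbs_specification \<Phi> \<Lambda> z x =
     exp (- energy \<Phi> \<Lambda> z x) / (\<Sum>y\<in>conf \<Lambda>. exp (- energy \<Phi> \<Lambda> z y))"

definition gibbs_random_field :: "('n::finite site \<Rightarrow> 'a::finite) measure \<Rightarrow> bool" where
  "gibbs_random_field P \<longleftrightarrow> random_field P \<and>
     (\<exists>\<Phi>. uniformly_convergent_potential \<Phi> \<and> version_of_cond_distr P (gibbs_specification \<Phi>))"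


section \<open>The two conditions on the one-point finite-conditional distribution\<close>

text \<open>
  Both conditions take the one-point part of a system of finite-conditional distributions:
  \<open>q t \<Delta> y x\<close> is the probability of \<open>x\<close> at \<open>t\<close> given \<open>y\<close> on \<open>\<Delta>\<close>.
\<close>

definition one_point_fin_cond ::
  "('n::finite site \<Rightarrow> 'a::finite) measure \<Rightarrow> 'n site \<Rightarrow> 'n site set \<Rightarrow>
   ('n site \<Rightarrow> 'a) \<Rightarrow> ('n site \<Rightarrow> 'a) \<Rightarrow> real" where
  "one_point_fin_cond P t = fin_cond P {t}"

definition uniformly_nonnull_limits ::
  "('n::finite site \<Rightarrow> 'n site set \<Rightarrow> ('n site \<Rightarrow> 'a::finite) \<Rightarrow> ('n site \<Rightarrow> 'a) \<Rightarrow> real) \<Rightarrow> bool" where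
  "uniformly_nonnull_limits q \<longleftrightarrow>
     (\<forall>t. \<forall>x\<in>conf {t}. \<exists>l.
        (\<forall>z\<in>conf (-{t}).
           ((\<lambda>\<Delta>. q t \<Delta> (restrict z \<Delta>) x) \<longlongrightarrow> l z) (finite_subsets_at_top (-{t}))) \<and>
        (\<exists>c>0. \<forall>z\<in>conf (-{t}). c \<le> l z) \<and>
        uniform_limit (conf (-{t})) (\<lambda>\<Delta> z. q t \<Delta> (restrict z \<Delta>) x) l
          (finite_subsets_at_top (-{t})))"

definition positive_limits ::
  "('n::finite site \<Rightarrow> 'n site set \<Rightarrow> ('n site \<Rightarrow> 'a::finite) \<Rightarrow> ('n site \<Rightarrow> 'a) \<Rightarrow> real) \<Rightarrow> bool" where
  "positive_limits q \<longleftrightarrow>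
     (\<forall>t. \<forall>x\<in>conf {t}. \<exists>l.
        (\<forall>z\<in>conf (-{t}).
           ((\<lambda>\<Delta>. q t \<Delta> (restrict z \<Delta>) x) \<longlongrightarrow> l z) (finite_subsets_at_top (-{t}))) \<and>
        (\<forall>z\<in>conf (-{t}). 0 < l z) \<and>
        uniform_limit (conf (-{t})) (\<lambda>\<Delta> z. q t \<Delta> (restrict z \<Delta>) x) l
          (finite_subsets_at_top (-{t})))"

end

theory Submission
  imports Defs
begin

text \<open>
  Let \<open>P\<close> be Gibbsian.  A finite-conditional probability is an average, over the configurations
  outside the window, of the Gibbsian specification, hence it differs from the specification by at
  most the oscillation of the latter over such configurations; this oscillation tends to 0 because
  the potential converges uniformly.  Strict positivity holds since a cylinder of probability 0
  would make the finite-conditional probabilities, and so their almost sure limits, vanish.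
  A strictly positive uniform limit of local functions is bounded below by compactness.

  Conversely, enumerate the lattice and fix a vacuum state.  Turning the sites into the vacuum one
  after the other, the limiting logarithmic probability ratio \<open>f i\<close> of the \<open>i\<close>-th step is a uniform
  limit of local functions and depends on the sites from the \<open>i\<close>-th on only.  Telescoping \<open>f i\<close> along
  windows that grow fast enough for the increments to be summable gives a potential carried by
  intervals of the enumeration.  Only finitely many first points \<open>i\<close> matter at a given site, so the
  potential is uniformly absolutely summable, and the sum of the \<open>f i\<close> recovers the logarithmic
  probability ratio of two configurations that differ at finitely many sites.
\<close>

section \<open>Cylinder probabilities\<close>

text \<open>The argument is a configuration on the whole lattice of which only the values on
  \<open>\<Delta>\<close> count. One and the same \<open>\<omega>\<close> thus serves every window,
  and supports need no bookkeeping while the window grows.\<close>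

definition cyl_prob ::
  "('n::finite site \<Rightarrow> 'a::finite) measure \<Rightarrow> 'n site set \<Rightarrow> ('n site \<Rightarrow> 'a) \<Rightarrow> real" where
  "cyl_prob P \<Delta> \<omega> = measure P {\<eta>. \<forall>s\<in>\<Delta>. \<eta> s = \<omega> s}"

abbreviation glue :: "'n::finite site set \<Rightarrow> ('n site \<Rightarrow> 'a::finite) \<Rightarrow> ('n site \<Rightarrow> 'a) \<Rightarrow> 'n site \<Rightarrow> 'a" where
  "glue \<Lambda> x z \<equiv> merge \<Lambda> (- \<Lambda>) (x, z)"

lemma finite_conf: "finite \<Lambda> \<Longrightarrow> finite (conf \<Lambda>)"
  by (simp add: conf_def finite_PiE)

lemma restrict_in_conf [simp]: "restrict \<omega> S \<in> conf S"
  by (simp add: conf_def)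

lemma conf_nonempty: "conf S \<noteq> {}"
  using restrict_in_conf by blast

lemma conf_eqI: "x \<in> conf S \<Longrightarrow> y \<in> conf S \<Longrightarrow> (\<And>s. s \<in> S \<Longrightarrow> x s = y s) \<Longrightarrow> x = y"
  unfolding conf_def by (rule PiE_ext)

lemma cyl_prob_cong: "(\<And>s. s \<in> \<Delta> \<Longrightarrow> \<omega> s = \<omega>' s) \<Longrightarrow> cyl_prob P \<Delta> \<omega> = cyl_prob P \<Delta> \<omega>'"
  unfolding cyl_prob_def by (metis (no_types, lifting))

lemma cyl_prob_restrict: "\<Delta> \<subseteq> S \<Longrightarrow> cyl_prob P \<Delta> (restrict \<omega> S) = cyl_prob P \<Delta> \<omega>"
  by (rule cyl_prob_cong) auto

lemma random_field_space:
  assumes "random_field P" shows "space P = UNIV"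
  using assms sets_eq_imp_space_eq[of P "conf_space UNIV"]
  by (auto simp: random_field_def conf_space_def space_PiM)

lemma random_field_prob_space: "random_field P \<Longrightarrow> prob_space P"
  by (simp add: random_field_def)

lemma singleton_in_conf_space:
  assumes "finite \<Delta>" "y \<in> conf \<Delta>"
  shows "{y} \<in> sets (conf_space \<Delta>)"
proof -
  have "PiE \<Delta> (\<lambda>s. {y s}) \<in> sets (conf_space \<Delta>)"
    unfolding conf_space_def using assms by (intro sets_PiM_I_finite) auto
  moreover have "PiE \<Delta> (\<lambda>s. {y s}) = {y}"
    using assms by (intro PiE_singleton) (auto simp: conf_def PiE_def)
  ultimately show ?thesis by simp
qed

lemma restrict_measurable_conf_space:
  assumes "random_field P"
  shows "(\<lambda>\<omega>. restrict \<omega> S) \<in> measurable P (conf_space S)"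
proof -
  have "(\<lambda>\<omega>. restrict \<omega> S) \<in> measurable (conf_space UNIV) (conf_space S)"
    unfolding conf_space_def by (rule measurable_restrict_subset) simp
  then show ?thesis
    using assms by (simp add: random_field_def cong: measurable_cong_sets)
qed

lemma vimage_restrict_singleton:
  assumes "y \<in> conf \<Delta>"
  shows "(\<lambda>\<omega>. restrict \<omega> \<Delta>) -` {y} = {\<eta>. \<forall>s\<in>\<Delta>. \<eta> s = y s}"
proof -
  have "restrict \<eta> \<Delta> = y \<longleftrightarrow> (\<forall>s\<in>\<Delta>. \<eta> s = y s)" for \<eta>
  proof
    assume "\<forall>s\<in>\<Delta>. \<eta> s = y s"
    then show "restrict \<eta> \<Delta> = y"
      by (intro conf_eqI[OF restrict_in_conf assms]) simp
  qed auto
  then show ?thesis by auto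
qed

lemma cylinder_in_sets:
  assumes "random_field P" "finite \<Delta>"
  shows "{\<eta>. \<forall>s\<in>\<Delta>. \<eta> s = \<omega> s} \<in> sets P"
proof -
  have "(\<lambda>\<omega>. restrict \<omega> \<Delta>) -` {restrict \<omega> \<Delta>} \<inter> space P \<in> sets P"
    by (rule measurable_sets[OF restrict_measurable_conf_space[OF assms(1)]
        singleton_in_conf_space[OF assms(2) restrict_in_conf]])
  then show ?thesis
    by (simp add: vimage_restrict_singleton random_field_space[OF assms(1)])
qed

lemma measure_marginal_singleton:
  assumes "random_field P" "finite \<Delta>" "y \<in> conf \<Delta>"
  shows "measure (marginal P \<Delta>) {y} = cyl_prob P \<Delta> y"
  unfolding marginal_def cyl_prob_def
  using measure_distr[OF restrict_measurable_conf_space[OF assms(1)]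
      singleton_in_conf_space[OF assms(2,3)]]
  by (simp add: vimage_restrict_singleton[OF assms(3)] random_field_space[OF assms(1)])

lemma strictly_positive_iff_cyl_prob:
  assumes "random_field P"
  shows "strictly_positive P \<longleftrightarrow> (\<forall>\<Delta> \<omega>. finite \<Delta> \<longrightarrow> cyl_prob P \<Delta> \<omega> > 0)"
proof
  assume *: "strictly_positive P"
  show "\<forall>\<Delta> \<omega>. finite \<Delta> \<longrightarrow> cyl_prob P \<Delta> \<omega> > 0"
  proof (intro allI impI)
    fix \<Delta> \<omega> assume \<Delta>: "finite (\<Delta> :: 'a site set)"
    then have "measure (marginal P \<Delta>) {restrict \<omega> \<Delta>} > 0"
      using * by (auto simp: strictly_positive_def fin_subsets_def)
    then show "cyl_prob P \<Delta> \<omega> > 0"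
      using measure_marginal_singleton[OF assms \<Delta> restrict_in_conf, of \<omega>]
      by (simp add: cyl_prob_restrict)
  qed
qed (use measure_marginal_singleton[OF assms] in \<open>auto simp: strictly_positive_def fin_subsets_def\<close>)

lemma merge_in_conf: "merge \<Lambda> \<Delta> xy \<in> conf (\<Lambda> \<union> \<Delta>)"
  by (cases xy) (auto simp: conf_def merge_def split: if_splits)

text \<open>On the right the configurations no longer change with \<open>\<Delta>\<close>: in all
  limits below only the windows of the two cylinders vary.\<close>

lemma fin_cond_eq_cyl_prob:
  assumes "random_field P" "finite \<Lambda>" "finite \<Delta>" "\<Lambda> \<inter> \<Delta> = {}"
  shows "fin_cond P \<Lambda> \<Delta> (restrict z \<Delta>) x = cyl_prob P (\<Lambda> \<union> \<Delta>) (glue \<Lambda> x z) / cyl_prob P \<Delta> z"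
proof -
  have "cyl_prob P (\<Lambda> \<union> \<Delta>) (merge \<Lambda> \<Delta> (x, restrict z \<Delta>)) = cyl_prob P (\<Lambda> \<union> \<Delta>) (glue \<Lambda> x z)"
    using assms(4) by (intro cyl_prob_cong) (auto simp: merge_def)
  then show ?thesis
    unfolding fin_cond_def
    using assms measure_marginal_singleton[OF assms(1) _ merge_in_conf]
      measure_marginal_singleton[OF assms(1,3) restrict_in_conf]
    by (simp add: cyl_prob_restrict)
qed

text \<open>Consistency of the marginals: prescribing in addition the values on
  \<open>\<Lambda>\<close> splits the cylinder on \<open>\<Delta>\<close> into finitely many
  disjoint ones.\<close>

lemma cyl_prob_sum:
  fixes P :: "('n::finite site \<Rightarrow> 'a::finite) measure"
  assumes "random_field P" "finite \<Lambda>" "finite \<Delta>" "\<Lambda> \<inter> \<Delta> = {}"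
  shows "cyl_prob P \<Delta> z = (\<Sum>y\<in>conf \<Lambda>. cyl_prob P (\<Lambda> \<union> \<Delta>) (glue \<Lambda> y z))"
proof -
  interpret prob_space P using assms(1) by (rule random_field_prob_space)
  let ?C = "\<lambda>y :: 'n site \<Rightarrow> 'a. {\<eta>. \<forall>s\<in>\<Lambda>\<union>\<Delta>. \<eta> s = glue \<Lambda> y z s}"
  have "disjoint_family_on ?C (conf \<Lambda>)"
    unfolding disjoint_family_on_def
  proof (intro ballI impI)
    fix y y' :: "'n site \<Rightarrow> 'a" assume y: "y \<in> conf \<Lambda>" "y' \<in> conf \<Lambda>" "y \<noteq> y'"
    then obtain s where "s \<in> \<Lambda>" "y s \<noteq> y' s" using conf_eqI by blast
    then have "\<eta> \<notin> ?C y'" if "\<eta> \<in> ?C y" for \<eta>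
      using that by (auto simp: merge_def dest!: bspec[where x = s])
    then show "?C y \<inter> ?C y' = {}" by blast
  qed
  then have "measure P (\<Union>y\<in>conf \<Lambda>. ?C y) = (\<Sum>y\<in>conf \<Lambda>. measure P (?C y))"
    using cylinder_in_sets[OF assms(1)] assms(2,3)
    by (intro finite_measure_finite_Union) (auto simp: finite_conf)
  moreover have "(\<Union>y\<in>conf \<Lambda>. ?C y) = {\<eta>. \<forall>s\<in>\<Delta>. \<eta> s = z s}"
  proof (intro equalityI subsetI)
    fix \<eta> assume "\<eta> \<in> {\<eta>. \<forall>s\<in>\<Delta>. \<eta> s = z s}"
    then have "\<eta> \<in> ?C (restrict \<eta> \<Lambda>)" by (auto simp: merge_def)
    then show "\<eta> \<in> (\<Union>y\<in>conf \<Lambda>. ?C y)" using restrict_in_conf by blast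
  next
    fix \<eta> assume "\<eta> \<in> (\<Union>y\<in>conf \<Lambda>. ?C y)"
    then obtain y where "\<And>s. s \<in> \<Delta> \<Longrightarrow> \<eta> s = glue \<Lambda> y z s" by blast
    moreover have "glue \<Lambda> y z s = z s" if "s \<in> \<Delta>" for s
      using that assms(4) by (auto simp: merge_def)
    ultimately show "\<eta> \<in> {\<eta>. \<forall>s\<in>\<Delta>. \<eta> s = z s}" by simp
  qed
  ultimately show ?thesis by (simp add: cyl_prob_def)
qed

lemma sum_normalized_eq_1:
  fixes f :: "('n::finite site \<Rightarrow> 'a::finite) \<Rightarrow> real"
  assumes "finite (\<Lambda> :: 'n site set)" "\<And>y. f y > 0"
  shows "(\<Sum>x\<in>conf \<Lambda>. f x / (\<Sum>y\<in>conf \<Lambda>. f y)) = 1"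
proof -
  have "(\<Sum>y\<in>conf \<Lambda>. f y) > 0"
    using assms by (intro sum_pos finite_conf conf_nonempty) auto
  then show ?thesis by (simp flip: sum_divide_distrib)
qed

lemma gibbs_specification_pos: "finite \<Lambda> \<Longrightarrow> gibbs_specification \<Phi> \<Lambda> z x > 0"
  unfolding gibbs_specification_def
  by (intro divide_pos_pos sum_pos finite_conf conf_nonempty) auto

section \<open>Passing between windows in the complement of a finite set and windows in the whole
  lattice\<close>

lemma filterlim_Diff_finite_subsets_at_top:
  assumes "finite \<Lambda>"
  shows "filterlim (\<lambda>\<Delta>. \<Delta> - \<Lambda>) (finite_subsets_at_top (- \<Lambda>)) (finite_subsets_at_top UNIV)"
  unfolding filterlim_finite_subsets_at_top
proof (intro allI impI)
  fix X :: "'a set" assume "finite X \<and> X \<subseteq> - \<Lambda>"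
  then show "\<forall>\<^sub>F \<Delta> in finite_subsets_at_top UNIV. finite (\<Delta> - \<Lambda>) \<and> X \<subseteq> \<Delta> - \<Lambda> \<and> \<Delta> - \<Lambda> \<subseteq> - \<Lambda>"
    using assms unfolding eventually_finite_subsets_at_top
    by (intro exI[of _ X]) auto
qed

lemma filterlim_Un_finite_subsets_at_top:
  assumes "finite \<Lambda>"
  shows "filterlim (\<lambda>\<Delta>. \<Lambda> \<union> \<Delta>) (finite_subsets_at_top UNIV) (finite_subsets_at_top (- \<Lambda>))"
  unfolding filterlim_finite_subsets_at_top
proof (intro allI impI)
  fix X :: "'a set" assume "finite X \<and> X \<subseteq> UNIV"
  then show "\<forall>\<^sub>F \<Delta> in finite_subsets_at_top (- \<Lambda>). finite (\<Lambda> \<union> \<Delta>) \<and> X \<subseteq> \<Lambda> \<union> \<Delta> \<and> \<Lambda> \<union> \<Delta> \<subseteq> UNIV"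
    using assms unfolding eventually_finite_subsets_at_top
    by (intro exI[of _ "X - \<Lambda>"]) auto
qed

lemma eventually_finite_superset:
  assumes "finite A" "A \<subseteq> S"
  shows "\<forall>\<^sub>F \<Delta> in finite_subsets_at_top S. finite \<Delta> \<and> A \<subseteq> \<Delta> \<and> \<Delta> \<subseteq> S"
  using assms unfolding eventually_finite_subsets_at_top by auto

section \<open>An enumeration of the lattice\<close>

text \<open>The constant vectors embed the integers. Infinity of the lattice makes the enumeration a
  bijection onto the natural numbers.\<close>

lemma infinite_UNIV_site: "infinite (UNIV :: 'n::finite site set)"
proof
  assume "finite (UNIV :: 'n site set)"
  then have "finite (range (\<lambda>k::int. (\<chi> i::'n. k)))" by (rule finite_subset[rotated]) simp
  moreover have "inj (\<lambda>k::int. (\<chi> i::'n. k))" by (auto simp: inj_def vec_eq_iff)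
  ultimately show False using finite_imageD infinite_UNIV_int by blast
qed

definition site_index :: "'n::finite site \<Rightarrow> nat" where
  "site_index = to_nat_on UNIV"

definition initial_sites :: "nat \<Rightarrow> 'n::finite site set" where
  "initial_sites n = {s. site_index s < n}"

lemma bij_site_index: "bij (site_index :: 'n::finite site \<Rightarrow> nat)"
  unfolding site_index_def by (intro to_nat_on_infinite infinite_UNIV_site) simp

lemma finite_initial_sites: "finite (initial_sites n)"
  unfolding initial_sites_def
  using finite_vimageI[of "{..<n}", OF _ bij_is_inj[OF bij_site_index]] by (simp add: vimage_def)

lemma initial_sites_mono: "m \<le> n \<Longrightarrow> initial_sites m \<subseteq> initial_sites n"
  by (auto simp: initial_sites_def)

lemma finite_subset_initial_sites:
  assumes "finite A" shows "\<exists>n. A \<subseteq> initial_sites n"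
proof -
  have "A \<subseteq> initial_sites (Suc (Max (site_index ` A)))"
    using assms by (auto simp: initial_sites_def less_Suc_eq_le)
  then show ?thesis ..
qed

lemma filterlim_initial_sites:
  "filterlim initial_sites (finite_subsets_at_top UNIV) sequentially"
  unfolding filterlim_finite_subsets_at_top
proof (intro allI impI)
  fix X :: "'a site set" assume "finite X \<and> X \<subseteq> UNIV"
  then obtain n where n: "X \<subseteq> initial_sites n" using finite_subset_initial_sites by blast
  then have "X \<subseteq> initial_sites m" if "m \<ge> n" for m
    using initial_sites_mono[OF that] by blast
  then show "\<forall>\<^sub>F m in sequentially. finite (initial_sites m :: 'a site set) \<and> X \<subseteq> initial_sites m \<and>
      (initial_sites m :: 'a site set) \<subseteq> UNIV"
    by (auto simp: eventually_sequentially finite_initial_sites)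
qed

section \<open>Positive limits are uniformly nonnull\<close>

text \<open>Compactness: around each \<open>z\<close> the function \<open>l\<close> is bounded below
  by a positive constant on a whole cylinder, and finitely many such cylinders cover the space of
  configurations.\<close>

lemma uniform_limit_local_bounded_below:
  fixes f :: "'n::finite site set \<Rightarrow> ('n site \<Rightarrow> 'a::finite) \<Rightarrow> real"
  assumes lim: "uniform_limit (conf S) (\<lambda>\<Delta> z. f \<Delta> (restrict z \<Delta>)) l (finite_subsets_at_top S)"
    and pos: "\<And>z. z \<in> conf S \<Longrightarrow> 0 < l z"
  shows "\<exists>c>0. \<forall>z\<in>conf S. c \<le> l z"
proof -
  \<comment> \<open>If a function of the values on \<open>\<Delta>\<close> is within
    \<open>l z / 3\<close> of \<open>l\<close>, then going from \<open>z\<close> to a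
    \<open>w\<close> that agrees with it on \<open>\<Delta>\<close> costs two such errors, so a
    third of \<open>l z\<close> is left.\<close>
  have "\<exists>\<Delta>. finite \<Delta> \<and> \<Delta> \<subseteq> S \<and>
      (\<forall>w\<in>conf S. (\<forall>s\<in>\<Delta>. w s = z s) \<longrightarrow> l z / 3 \<le> l w)" if z: "z \<in> conf S" for z
  proof -
    have "\<forall>\<^sub>F \<Delta> in finite_subsets_at_top S. \<forall>w\<in>conf S. dist (f \<Delta> (restrict w \<Delta>)) (l w) < l z / 3"
      using pos[OF z] by (intro uniform_limitD[OF lim]) simp
    then obtain \<Delta> where \<Delta>: "finite \<Delta>" "\<Delta> \<subseteq> S"
      and near: "\<And>w. w \<in> conf S \<Longrightarrow> dist (f \<Delta> (restrict w \<Delta>)) (l w) < l z / 3"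
      unfolding eventually_finite_subsets_at_top by (metis order_refl)
    have "l z / 3 \<le> l w" if w: "w \<in> conf S" "\<forall>s\<in>\<Delta>. w s = z s" for w
    proof -
      have "restrict w \<Delta> = restrict z \<Delta>" using w(2) by auto
      then show ?thesis
        using near[OF z] near[OF w(1)] by (simp add: dist_real_def abs_less_iff del: restrict_apply) argo
    qed
    with \<Delta> show ?thesis by blast
  qed
  then obtain D where D: "\<And>z. z \<in> conf S \<Longrightarrow> finite (D z)" "\<And>z. z \<in> conf S \<Longrightarrow> D z \<subseteq> S"
    and low: "\<And>z w. z \<in> conf S \<Longrightarrow> w \<in> conf S \<Longrightarrow> (\<forall>s\<in>D z. w s = z s) \<Longrightarrow> l z / 3 \<le> l w"
    by metis
  \<comment> \<open>Finite discrete factors make this product compact. The sets \<open>?U z\<close>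
    are the cylinders given by \<open>z\<close> on \<open>D z\<close>, which are basic open
    sets.\<close>
  let ?X = "product_topology (\<lambda>_. discrete_topology (UNIV :: 'a set)) S"
  let ?U = "\<lambda>z. PiE S (\<lambda>s. if s \<in> D z then {z s} else UNIV)"
  have X: "topspace ?X = conf S" by (simp add: conf_def)
  have "compact_space ?X"
    by (simp add: compact_space_product_topology compact_space_discrete_topology)
  moreover have "openin ?X (?U z)" if "z \<in> conf S" for z :: "'n site \<Rightarrow> 'a"
  proof -
    have "finite {s. (if s \<in> D z then {z s} else UNIV) \<noteq> UNIV}"
      by (rule finite_subset[OF _ D(1)[OF that]]) auto
    then show ?thesis by (intro product_topology_basis) auto
  qed
  moreover have cover: "conf S \<subseteq> \<Union> (?U ` conf S)"
  proof
    fix z :: "'n site \<Rightarrow> 'a" assume "z \<in> conf S"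
    moreover from this have "z \<in> ?U z" by (auto simp: conf_def PiE_iff)
    ultimately show "z \<in> \<Union> (?U ` conf S)" by blast
  qed
  ultimately obtain \<F> where "finite \<F>" "\<F> \<subseteq> ?U ` conf S" "conf S \<subseteq> \<Union>\<F>"
    unfolding compact_space_def compactin_def X
    by (metis (no_types, lifting) imageE)
  then obtain Z where Z: "finite Z" "Z \<subseteq> conf S" "conf S \<subseteq> \<Union> (?U ` Z)"
    by (metis (no_types, lifting) finite_subset_image)
  from Z(3) have "Z \<noteq> {}" using conf_nonempty by blast
  define c where "c = Min ((\<lambda>z. l z / 3) ` Z)"
  have "c > 0" unfolding c_def using Z \<open>Z \<noteq> {}\<close> pos by (subst Min_gr_iff) auto
  moreover have "c \<le> l w" if w: "w \<in> conf S" for w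
  proof -
    obtain z where z: "z \<in> Z" "w \<in> ?U z" using Z(3) w by blast
    then have "z \<in> conf S" using Z(2) by blast
    have "w s = z s" if "s \<in> D z" for s
      using PiE_mem[OF z(2), of s] that D(2)[OF \<open>z \<in> conf S\<close>] by auto
    then have "l z / 3 \<le> l w" using low[OF \<open>z \<in> conf S\<close> w] by blast
    moreover have "c \<le> l z / 3" unfolding c_def using Z(1) z(1) by (intro Min_le) auto
    ultimately show ?thesis by simp
  qed
  ultimately show ?thesis by blast
qed

text \<open>The probabilities in the window \<open>\<Delta>\<close> are by their form functions of
  \<open>restrict z \<Delta>\<close>, so the compactness argument applies to any system
  \<open>q\<close>.\<close>

lemma uniformly_nonnull_limits_iff_positive_limits:
  fixes q :: "'n::finite site \<Rightarrow> 'n site set \<Rightarrow> ('n site \<Rightarrow> 'a::finite) \<Rightarrow> ('n site \<Rightarrow> 'a) \<Rightarrow> real"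
  shows "uniformly_nonnull_limits q \<longleftrightarrow> positive_limits q"
proof
  assume "uniformly_nonnull_limits q"
  then show "positive_limits q"
    unfolding uniformly_nonnull_limits_def positive_limits_def by (meson less_le_trans)
next
  assume *: "positive_limits q"
  show "uniformly_nonnull_limits q"
    unfolding uniformly_nonnull_limits_def
  proof (intro allI ballI)
    fix t :: "'n site" and x :: "'n site \<Rightarrow> 'a" assume "x \<in> conf {t}"
    with * obtain l where l:
      "\<forall>z\<in>conf (- {t}). ((\<lambda>\<Delta>. q t \<Delta> (restrict z \<Delta>) x) \<longlongrightarrow> l z) (finite_subsets_at_top (- {t}))"
      "\<forall>z\<in>conf (- {t}). 0 < l z"
      "uniform_limit (conf (- {t})) (\<lambda>\<Delta> z. q t \<Delta> (restrict z \<Delta>) x) l (finite_subsets_at_top (- {t}))"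
      unfolding positive_limits_def by blast
    from uniform_limit_local_bounded_below[OF l(3)] l(2)
    have "\<exists>c>0. \<forall>z\<in>conf (- {t}). c \<le> l z" by blast
    with l show "\<exists>l. (\<forall>z\<in>conf (- {t}). ((\<lambda>\<Delta>. q t \<Delta> (restrict z \<Delta>) x) \<longlongrightarrow> l z) (finite_subsets_at_top (- {t}))) \<and>
        (\<exists>c>0. \<forall>z\<in>conf (- {t}). c \<le> l z) \<and>
        uniform_limit (conf (- {t})) (\<lambda>\<Delta> z. q t \<Delta> (restrict z \<Delta>) x) l (finite_subsets_at_top (- {t}))"
      by blast
  qed
qed

section \<open>Gibbs random fields have positive uniform limits\<close>

lemma cyl_prob_nonneg: "cyl_prob P \<Delta> \<omega> \<ge> 0"
  by (simp add: cyl_prob_def)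

lemma cyl_prob_antimono:
  assumes "random_field P" "finite \<Delta>" "\<Delta> \<subseteq> \<Delta>'"
  shows "cyl_prob P \<Delta>' \<omega> \<le> cyl_prob P \<Delta> \<omega>"
proof -
  interpret prob_space P using assms(1) by (rule random_field_prob_space)
  show ?thesis unfolding cyl_prob_def
    using assms by (intro finite_measure_mono cylinder_in_sets) auto
qed

text \<open>Moves the almost sure convergence from the marginal outside \<open>\<Lambda>\<close> to
  \<open>P\<close> itself, so that it can be integrated over cylinders of the full space.\<close>

lemma version_of_cond_distr_AE:
  fixes P :: "('n::finite site \<Rightarrow> 'a::finite) measure"
  assumes rf: "random_field P" and ver: "version_of_cond_distr P Q"
    and \<Lambda>: "finite \<Lambda>" and x: "x \<in> conf \<Lambda>"
  shows "AE \<eta> in P.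
    ((\<lambda>\<Delta>. cyl_prob P (\<Lambda> \<union> \<Delta>) (glue \<Lambda> x \<eta>) / cyl_prob P \<Delta> \<eta>) \<longlongrightarrow> Q \<Lambda> (restrict \<eta> (- \<Lambda>)) x)
      (finite_subsets_at_top (- \<Lambda>))"
proof -
  have "AE z in marginal P (- \<Lambda>). \<forall>x\<in>conf \<Lambda>.
      ((\<lambda>\<Delta>. fin_cond P \<Lambda> \<Delta> (restrict z \<Delta>) x) \<longlongrightarrow> Q \<Lambda> z x) (finite_subsets_at_top (- \<Lambda>))"
    using ver \<Lambda> unfolding version_of_cond_distr_def fin_subsets_def by blast
  from AE_distrD[OF restrict_measurable_conf_space[OF rf] this[unfolded marginal_def]]
  show ?thesis
  proof (eventually_elim)
    fix \<eta> :: "'n site \<Rightarrow> 'a"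
    let ?z = "restrict \<eta> (- \<Lambda>)"
    assume "\<forall>x\<in>conf \<Lambda>.
      ((\<lambda>\<Delta>. fin_cond P \<Lambda> \<Delta> (restrict ?z \<Delta>) x) \<longlongrightarrow> Q \<Lambda> ?z x) (finite_subsets_at_top (- \<Lambda>))"
    then have lim: "((\<lambda>\<Delta>. fin_cond P \<Lambda> \<Delta> (restrict ?z \<Delta>) x) \<longlongrightarrow> Q \<Lambda> ?z x)
        (finite_subsets_at_top (- \<Lambda>))"
      using x by blast
    have "\<forall>\<^sub>F \<Delta> in finite_subsets_at_top (- \<Lambda>). fin_cond P \<Lambda> \<Delta> (restrict ?z \<Delta>) x =
        cyl_prob P (\<Lambda> \<union> \<Delta>) (glue \<Lambda> x \<eta>) / cyl_prob P \<Delta> \<eta>"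
    proof (rule eventually_finite_subsets_at_top_weakI)
      fix \<Delta> assume \<Delta>: "finite \<Delta>" "\<Delta> \<subseteq> - \<Lambda>"
      have "glue \<Lambda> x ?z = glue \<Lambda> x \<eta>" by (auto simp: merge_def)
      moreover have "\<Lambda> \<inter> \<Delta> = {}" using \<Delta> by auto
      ultimately show "fin_cond P \<Lambda> \<Delta> (restrict ?z \<Delta>) x =
          cyl_prob P (\<Lambda> \<union> \<Delta>) (glue \<Lambda> x \<eta>) / cyl_prob P \<Delta> \<eta>"
        using fin_cond_eq_cyl_prob[OF rf \<Lambda> \<Delta>(1), of ?z x] cyl_prob_restrict[OF \<Delta>(2), of P \<eta>] by simp
    qed
    with lim show "((\<lambda>\<Delta>. cyl_prob P (\<Lambda> \<union> \<Delta>) (glue \<Lambda> x \<eta>) / cyl_prob P \<Delta> \<eta>) \<longlongrightarrow> Q \<Lambda> ?z x)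
        (finite_subsets_at_top (- \<Lambda>))"
      by (rule Lim_transform_eventually)
  qed
qed

text \<open>If a cylinder on \<open>\<Lambda>\<close> is null, so is every smaller one. All the
  quotients that converge almost surely to the positive value of \<open>Q\<close> are then 0, which
  is impossible on a probability space.\<close>

lemma positive_version_imp_strictly_positive:
  fixes P :: "('n::finite site \<Rightarrow> 'a::finite) measure"
  assumes rf: "random_field P" and ver: "version_of_cond_distr P Q"
    and pos: "\<And>\<Lambda> z x. finite \<Lambda> \<Longrightarrow> Q \<Lambda> z x > 0"
  shows "strictly_positive P"
  unfolding strictly_positive_iff_cyl_prob[OF rf]
proof (intro allI impI, rule ccontr)
  fix \<Lambda> and \<omega> :: "'n site \<Rightarrow> 'a" assume \<Lambda>: "finite \<Lambda>" and "\<not> 0 < cyl_prob P \<Lambda> \<omega>"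
  then have zero: "cyl_prob P \<Lambda> \<omega> = 0" using cyl_prob_nonneg[of P \<Lambda> \<omega>] by simp
  let ?x = "restrict \<omega> \<Lambda>"
  interpret prob_space P using rf by (rule random_field_prob_space)
  have "cyl_prob P (\<Lambda> \<union> \<Delta>) (glue \<Lambda> ?x \<eta>) = 0" for \<Delta> and \<eta> :: "'n site \<Rightarrow> 'a"
  proof -
    have "cyl_prob P (\<Lambda> \<union> \<Delta>) (glue \<Lambda> ?x \<eta>) \<le> cyl_prob P \<Lambda> (glue \<Lambda> ?x \<eta>)"
      by (intro cyl_prob_antimono[OF rf \<Lambda>]) simp
    also have "\<dots> = cyl_prob P \<Lambda> \<omega>" by (rule cyl_prob_cong) (simp add: merge_def)
    finally show ?thesis using zero cyl_prob_nonneg[of P "\<Lambda> \<union> \<Delta>" "glue \<Lambda> ?x \<eta>"] by simp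
  qed
  with version_of_cond_distr_AE[OF rf ver \<Lambda> restrict_in_conf, of \<omega>]
  have "AE \<eta> in P. ((\<lambda>\<Delta>::'n site set. 0) \<longlongrightarrow> Q \<Lambda> (restrict \<eta> (- \<Lambda>)) ?x) (finite_subsets_at_top (- \<Lambda>))"
    by simp
  then have "AE \<eta> in P. False"
  proof (eventually_elim)
    fix \<eta> :: "'n site \<Rightarrow> 'a" assume "((\<lambda>\<Delta>::'n site set. 0) \<longlongrightarrow> Q \<Lambda> (restrict \<eta> (- \<Lambda>)) ?x) (finite_subsets_at_top (- \<Lambda>))"
    then have "Q \<Lambda> (restrict \<eta> (- \<Lambda>)) ?x = 0"
      by (simp add: tendsto_const_iff)
    then show False using pos[OF \<Lambda>, of "restrict \<eta> (- \<Lambda>)" ?x] by simp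
  qed
  then show False by simp
qed

section \<open>Finite-conditional probabilities as averages of a version of the conditional
  distribution\<close>

text \<open>The law of total probability: averaging the conditional probability given the larger
  window \<open>W\<close> over the cylinder on \<open>\<Delta>\<close> gives a value that no longer
  depends on \<open>W\<close>.\<close>

lemma integral_fin_cond_on_cylinder:
  fixes P :: "('n::finite site \<Rightarrow> 'a::finite) measure" and x z :: "'n site \<Rightarrow> 'a"
  assumes rf: "random_field P" and sp: "strictly_positive P"
    and \<Lambda>: "finite \<Lambda>" and W: "finite W" "W \<inter> \<Lambda> = {}" and \<Delta>: "\<Delta> \<subseteq> W"
  defines "h \<equiv> \<lambda>\<eta>. indicator {\<eta>. \<forall>s\<in>\<Delta>. \<eta> s = z s} \<eta> * (cyl_prob P (\<Lambda> \<union> W) (glue \<Lambda> x \<eta>) / cyl_prob P W \<eta>)"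
  shows "h \<in> borel_measurable P"
    and "(\<integral>\<eta>. h \<eta> \<partial>P) = cyl_prob P (\<Lambda> \<union> \<Delta>) (glue \<Lambda> x z)"
proof -
  interpret prob_space P using rf by (rule random_field_prob_space)
  let ?q = "\<lambda>\<eta>. cyl_prob P (\<Lambda> \<union> W) (glue \<Lambda> x \<eta>) / cyl_prob P W \<eta>"
  \<comment> \<open>\<open>?u y\<close> has the values \<open>y\<close> on
    \<open>W - \<Delta>\<close> and \<open>z\<close> elsewhere. The cylinders \<open>?A y\<close>
    partition the cylinder of \<open>z\<close> on \<open>\<Delta>\<close>, and \<open>h\<close> is
    constant on each of them, hence a step function.\<close>
  let ?u = "\<lambda>y. glue (W - \<Delta>) y z"
  let ?A = "\<lambda>y. {\<eta>. \<forall>s\<in>W. \<eta> s = ?u y s}"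
  have u: "\<eta> \<in> ?A y \<longleftrightarrow> \<eta> \<in> {\<eta>. \<forall>s\<in>\<Delta>. \<eta> s = z s} \<and> y = restrict \<eta> (W - \<Delta>)"
    if y: "y \<in> conf (W - \<Delta>)" for y \<eta> :: "'n site \<Rightarrow> 'a"
  proof (intro iffI conjI)
    assume *: "\<eta> \<in> ?A y"
    then show "\<eta> \<in> {\<eta>. \<forall>s\<in>\<Delta>. \<eta> s = z s}" using \<Delta> by (auto simp: merge_def)
    show "y = restrict \<eta> (W - \<Delta>)"
      using * by (intro conf_eqI[OF y restrict_in_conf]) (auto simp: merge_def)
  qed (use \<Delta> in \<open>auto simp: merge_def\<close>)
  have h: "h \<eta> = (\<Sum>y\<in>conf (W - \<Delta>). indicator (?A y) \<eta> * ?q (?u y))" for \<eta> :: "'n site \<Rightarrow> 'a"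
  proof -
    let ?C = "{\<eta>. \<forall>s\<in>\<Delta>. \<eta> s = z s}"
    have "(\<Sum>y\<in>conf (W - \<Delta>). indicator (?A y) \<eta> * ?q (?u y)) =
        (\<Sum>y\<in>conf (W - \<Delta>). if restrict \<eta> (W - \<Delta>) = y then indicator ?C \<eta> * ?q (?u y) else 0)"
      using u by (intro sum.cong refl) (auto simp: indicator_def)
    also have "\<dots> = indicator ?C \<eta> * ?q (?u (restrict \<eta> (W - \<Delta>)))"
      using W(1) by (subst sum.delta') (auto simp: finite_conf)
    also have "\<dots> = h \<eta>"
    proof (cases "\<eta> \<in> ?C")
      case True
      then have "cyl_prob P (\<Lambda> \<union> W) (glue \<Lambda> x (?u (restrict \<eta> (W - \<Delta>)))) = cyl_prob P (\<Lambda> \<union> W) (glue \<Lambda> x \<eta>)"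
        "cyl_prob P W (?u (restrict \<eta> (W - \<Delta>))) = cyl_prob P W \<eta>"
        by (intro cyl_prob_cong; auto simp: merge_def)+
      then show ?thesis by (simp add: h_def)
    qed (simp add: h_def)
    finally show ?thesis by simp
  qed
  have A: "?A y \<in> sets P" for y using cylinder_in_sets[OF rf W(1)] .
  have [measurable]: "indicator (?A y) \<in> borel_measurable P" for y
    using A by (rule borel_measurable_indicator)
  show "h \<in> borel_measurable P"
    unfolding h[abs_def] by measurable
  have pos: "cyl_prob P W y > 0" for y
    using sp W(1) by (simp add: strictly_positive_iff_cyl_prob[OF rf])
  have "(\<integral>\<eta>. h \<eta> \<partial>P) = (\<Sum>y\<in>conf (W - \<Delta>). cyl_prob P W (?u y) * ?q (?u y))"
  proof -
    have "(\<integral>\<eta>. h \<eta> \<partial>P) = (\<Sum>y\<in>conf (W - \<Delta>). \<integral>\<eta>. indicator (?A y) \<eta> * ?q (?u y) \<partial>P)"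
      unfolding h using A
      by (intro Bochner_Integration.integral_sum integrable_mult_left integrable_real_indicator)
        (auto simp: less_top[symmetric])
    also have "\<dots> = (\<Sum>y\<in>conf (W - \<Delta>). cyl_prob P W (?u y) * ?q (?u y))"
    proof (intro sum.cong refl)
      fix y
      have "(\<integral>\<eta>. indicator (?A y) \<eta> * c \<partial>P) = cyl_prob P W (?u y) * c" for c :: real
        using A[of y] by (simp add: random_field_space[OF rf] cyl_prob_def[of P W])
      then show "(\<integral>\<eta>. indicator (?A y) \<eta> * ?q (?u y) \<partial>P) = cyl_prob P W (?u y) * ?q (?u y)" .
    qed
    finally show ?thesis .
  qed
  \<comment> \<open>The weight of \<open>?A y\<close> cancels the denominator of the conditional
    probability. What remains is a sum over the values on \<open>W - \<Delta>\<close>, which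
    \<open>cyl_prob_sum\<close> collapses.\<close>
  also have "\<dots> = (\<Sum>y\<in>conf (W - \<Delta>). cyl_prob P ((W - \<Delta>) \<union> (\<Lambda> \<union> \<Delta>)) (glue (W - \<Delta>) y (glue \<Lambda> x z)))"
  proof (intro sum.cong refl)
    fix y
    have "cyl_prob P W (?u y) * ?q (?u y) = cyl_prob P (\<Lambda> \<union> W) (glue \<Lambda> x (?u y))"
      using pos[of "?u y"] by simp
    also have "\<dots> = cyl_prob P (\<Lambda> \<union> W) (glue (W - \<Delta>) y (glue \<Lambda> x z))"
      using W(2) by (intro cyl_prob_cong) (auto simp: merge_def)
    finally have "cyl_prob P W (?u y) * ?q (?u y) = cyl_prob P (\<Lambda> \<union> W) (glue (W - \<Delta>) y (glue \<Lambda> x z))" .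
    moreover have "(W - \<Delta>) \<union> (\<Lambda> \<union> \<Delta>) = \<Lambda> \<union> W" using \<Delta> by auto
    ultimately show "cyl_prob P W (?u y) * ?q (?u y) =
        cyl_prob P ((W - \<Delta>) \<union> (\<Lambda> \<union> \<Delta>)) (glue (W - \<Delta>) y (glue \<Lambda> x z))" by (simp only:)
  qed
  also have "\<dots> = cyl_prob P (\<Lambda> \<union> \<Delta>) (glue \<Lambda> x z)"
    using W \<Lambda> \<Delta> by (intro cyl_prob_sum[OF rf, symmetric]) (auto dest: finite_subset)
  finally show "(\<integral>\<eta>. h \<eta> \<partial>P) = cyl_prob P (\<Lambda> \<union> \<Delta>) (glue \<Lambda> x z)" .
qed

text \<open>
  Integrating the almost sure limit over the cylinder given by \<open>z\<close> on \<open>\<Delta>\<close> shows that the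
  finite-conditional probability is an average of values of \<open>Q\<close>.
\<close>

lemma fin_cond_between:
  fixes P :: "('n::finite site \<Rightarrow> 'a::finite) measure" and x z :: "'n site \<Rightarrow> 'a"
  assumes rf: "random_field P" and sp: "strictly_positive P" and ver: "version_of_cond_distr P Q"
    and \<Lambda>: "finite \<Lambda>" and x: "x \<in> conf \<Lambda>" and \<Delta>: "finite \<Delta>" "\<Delta> \<subseteq> - \<Lambda>"
    and bounds: "\<And>w. w \<in> conf (- \<Lambda>) \<Longrightarrow> \<forall>s\<in>\<Delta>. w s = z s \<Longrightarrow> a \<le> Q \<Lambda> w x \<and> Q \<Lambda> w x \<le> b"
  shows "a \<le> fin_cond P \<Lambda> \<Delta> (restrict z \<Delta>) x" and "fin_cond P \<Lambda> \<Delta> (restrict z \<Delta>) x \<le> b"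
proof -
  interpret prob_space P using rf by (rule random_field_prob_space)
  define C where "C = {\<eta>. \<forall>s\<in>\<Delta>. \<eta> s = z s}"
  obtain n\<^sub>0 where n\<^sub>0: "\<Delta> \<subseteq> initial_sites n\<^sub>0" using finite_subset_initial_sites[OF \<Delta>(1)] by blast
  \<comment> \<open>The shift by \<open>n\<^sub>0\<close> makes every window contain
    \<open>\<Delta>\<close>. A sequence replaces the net of all finite sets because dominated
    convergence is applied to sequences.\<close>
  define W where "W n = initial_sites (n + n\<^sub>0) - \<Lambda>" for n
  define q where "q n \<eta> = cyl_prob P (\<Lambda> \<union> W n) (glue \<Lambda> x \<eta>) / cyl_prob P (W n) \<eta>" for n :: nat and \<eta> :: "'n site \<Rightarrow> 'a"
  define h where "h n \<eta> = indicator C \<eta> * q n \<eta>" for n :: nat and \<eta> :: "'n site \<Rightarrow> 'a"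
  \<comment> \<open>No measurability of \<open>Q\<close> is given. The function \<open>lim\<close>
    of the measurable \<open>h n\<close> is measurable and agrees almost surely with
    \<open>Q\<close> on the cylinder \<open>C\<close>.\<close>
  define g where "g \<eta> = lim (\<lambda>n. h n \<eta>)" for \<eta> :: "'n site \<Rightarrow> 'a"
  have W: "finite (W n)" "W n \<inter> \<Lambda> = {}" "\<Delta> \<subseteq> W n" for n
    using n\<^sub>0 \<Delta>(2) initial_sites_mono[of n\<^sub>0 "n + n\<^sub>0"] by (auto simp: W_def finite_initial_sites)
  note integ = integral_fin_cond_on_cylinder[OF rf sp \<Lambda> W, where x = x and z = z]
  have h_meas [measurable]: "h n \<in> borel_measurable P" for n
    using integ(1)[of n] by (simp add: h_def[abs_def] q_def C_def)
  have h_int: "(\<integral>\<eta>. h n \<eta> \<partial>P) = cyl_prob P (\<Lambda> \<union> \<Delta>) (glue \<Lambda> x z)" for n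
    using integ(2)[of n] by (simp add: h_def[abs_def] q_def C_def)
  have g_meas [measurable]: "g \<in> borel_measurable P" unfolding g_def[abs_def] by measurable
  have C: "C \<in> sets P" unfolding C_def by (rule cylinder_in_sets[OF rf \<Delta>(1)])
  have h_le: "norm (h n \<eta>) \<le> 1" for n :: nat and \<eta> :: "'n site \<Rightarrow> 'a"
  proof -
    have "cyl_prob P (\<Lambda> \<union> W n) (glue \<Lambda> x \<eta>) \<le> cyl_prob P (W n) (glue \<Lambda> x \<eta>)"
      by (intro cyl_prob_antimono[OF rf W(1)]) simp
    also have "\<dots> = cyl_prob P (W n) \<eta>" using W(2)[of n] by (intro cyl_prob_cong) (auto simp: merge_def)
    finally have "q n \<eta> \<le> 1" unfolding q_def
      using sp W(1)[of n] by (simp add: divide_le_eq_1 strictly_positive_iff_cyl_prob[OF rf])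
    moreover have "q n \<eta> \<ge> 0" by (simp add: q_def cyl_prob_nonneg)
    ultimately show ?thesis by (auto simp: h_def indicator_def)
  qed
  have "filterlim (\<lambda>n. initial_sites (n + n\<^sub>0)) (finite_subsets_at_top UNIV) sequentially"
    by (rule filterlim_compose[OF filterlim_initial_sites filterlim_add_const_nat_at_top])
  then have W_lim: "filterlim W (finite_subsets_at_top (- \<Lambda>)) sequentially"
    unfolding W_def[abs_def] by (rule filterlim_compose[OF filterlim_Diff_finite_subsets_at_top[OF \<Lambda>]])
  have g: "AE \<eta> in P. (\<lambda>n. h n \<eta>) \<longlonglongrightarrow> g \<eta> \<and> a * indicator C \<eta> \<le> g \<eta> \<and> g \<eta> \<le> b * indicator C \<eta>"
    using version_of_cond_distr_AE[OF rf ver \<Lambda> x]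
  proof (eventually_elim)
    fix \<eta> :: "'n site \<Rightarrow> 'a"
    let ?z = "restrict \<eta> (- \<Lambda>)"
    assume "((\<lambda>\<Delta>. cyl_prob P (\<Lambda> \<union> \<Delta>) (glue \<Lambda> x \<eta>) / cyl_prob P \<Delta> \<eta>) \<longlongrightarrow> Q \<Lambda> ?z x)
        (finite_subsets_at_top (- \<Lambda>))"
    from filterlim_compose[OF this W_lim] have "(\<lambda>n. q n \<eta>) \<longlonglongrightarrow> Q \<Lambda> ?z x"
      by (simp add: q_def)
    then have lim: "(\<lambda>n. h n \<eta>) \<longlonglongrightarrow> indicator C \<eta> * Q \<Lambda> ?z x"
      unfolding h_def by (rule tendsto_mult_left)
    then have "g \<eta> = indicator C \<eta> * Q \<Lambda> ?z x" unfolding g_def by (rule limI)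
    moreover have "a \<le> Q \<Lambda> ?z x \<and> Q \<Lambda> ?z x \<le> b" if "\<eta> \<in> C"
      using that \<Delta>(2) by (intro bounds) (auto simp: C_def)
    ultimately show "(\<lambda>n. h n \<eta>) \<longlonglongrightarrow> g \<eta> \<and> a * indicator C \<eta> \<le> g \<eta> \<and> g \<eta> \<le> b * indicator C \<eta>"
      using lim by (cases "\<eta> \<in> C") auto
  qed
  from g have g_lim: "AE \<eta> in P. (\<lambda>n. h n \<eta>) \<longlonglongrightarrow> g \<eta>"
    and g_bounds: "AE \<eta> in P. a * indicator C \<eta> \<le> g \<eta>" "AE \<eta> in P. g \<eta> \<le> b * indicator C \<eta>"
    by (auto elim: eventually_mono)
  have one: "integrable P (\<lambda>_. 1 :: real)" by simp
  have "AE \<eta> in P. norm (h n \<eta>) \<le> 1" for n using h_le by simp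
  note dom = integrable_dominated_convergence[OF g_meas h_meas one g_lim this]
    integral_dominated_convergence[OF g_meas h_meas one g_lim this]
  \<comment> \<open>The integrals of the \<open>h n\<close> are all equal, so dominated convergence
    gives the same value for \<open>g\<close>.\<close>
  have g_int: "(\<integral>\<eta>. g \<eta> \<partial>P) = cyl_prob P (\<Lambda> \<union> \<Delta>) (glue \<Lambda> x z)"
    using dom(2) by (simp add: h_int LIMSEQ_const_iff)
  have cyl: "cyl_prob P \<Delta> z = measure P C" by (simp add: cyl_prob_def C_def)
  have ind: "integrable P (\<lambda>\<eta>. c * indicator C \<eta> :: real)"
    "(\<integral>\<eta>. c * indicator C \<eta> \<partial>P) = c * cyl_prob P \<Delta> z" for c
    using C unfolding cyl
    by (intro integrable_mult_right integrable_real_indicator)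
      (simp_all add: random_field_space[OF rf] less_top[symmetric])
  have "a * cyl_prob P \<Delta> z \<le> (\<integral>\<eta>. g \<eta> \<partial>P)" "(\<integral>\<eta>. g \<eta> \<partial>P) \<le> b * cyl_prob P \<Delta> z"
    unfolding ind(2)[symmetric] by (rule integral_mono_AE[OF ind(1) dom(1) g_bounds(1)], rule integral_mono_AE[OF dom(1) ind(1) g_bounds(2)])
  moreover have "cyl_prob P \<Delta> z > 0"
    using sp \<Delta>(1) by (simp add: strictly_positive_iff_cyl_prob[OF rf])
  moreover have "fin_cond P \<Lambda> \<Delta> (restrict z \<Delta>) x = (\<integral>\<eta>. g \<eta> \<partial>P) / cyl_prob P \<Delta> z"
    using \<Delta> by (subst fin_cond_eq_cyl_prob[OF rf \<Lambda>]) (auto simp: g_int)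
  ultimately show "a \<le> fin_cond P \<Lambda> \<Delta> (restrict z \<Delta>) x" "fin_cond P \<Lambda> \<Delta> (restrict z \<Delta>) x \<le> b"
    by (simp_all add: le_divide_eq divide_le_eq)
qed

text \<open>Once the window contains the set \<open>D\<close> belonging to \<open>e / 2\<close>, all
  values of \<open>Q\<close> entering the average lie within \<open>e / 2\<close> of the one at
  \<open>z\<close>. This gives convergence at every \<open>z\<close>, although \<open>Q\<close> is
  tied to \<open>P\<close> only almost surely.\<close>

lemma uniform_limit_fin_cond:
  fixes P :: "('n::finite site \<Rightarrow> 'a::finite) measure"
  assumes rf: "random_field P" and sp: "strictly_positive P" and ver: "version_of_cond_distr P Q"
    and \<Lambda>: "finite \<Lambda>" and x: "x \<in> conf \<Lambda>"
    and osc: "\<And>e. e > 0 \<Longrightarrow> \<exists>D. finite D \<and> D \<subseteq> - \<Lambda> \<and>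
      (\<forall>z\<in>conf (- \<Lambda>). \<forall>w\<in>conf (- \<Lambda>). (\<forall>s\<in>D. w s = z s) \<longrightarrow> \<bar>Q \<Lambda> w x - Q \<Lambda> z x\<bar> \<le> e)"
  shows "uniform_limit (conf (- \<Lambda>)) (\<lambda>\<Delta> z. fin_cond P \<Lambda> \<Delta> (restrict z \<Delta>) x) (\<lambda>z. Q \<Lambda> z x)
    (finite_subsets_at_top (- \<Lambda>))"
proof (rule uniform_limitI)
  fix e :: real assume "e > 0"
  then obtain D where D: "finite D" "D \<subseteq> - \<Lambda>"
    and close: "\<And>z w :: 'n site \<Rightarrow> 'a. z \<in> conf (- \<Lambda>) \<Longrightarrow> w \<in> conf (- \<Lambda>) \<Longrightarrow> \<forall>s\<in>D. w s = z s \<Longrightarrow>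
      \<bar>Q \<Lambda> w x - Q \<Lambda> z x\<bar> \<le> e / 2"
    using osc[of "e / 2"] by auto
  from eventually_finite_superset[OF D]
  show "\<forall>\<^sub>F \<Delta> in finite_subsets_at_top (- \<Lambda>). \<forall>z\<in>conf (- \<Lambda>).
      dist (fin_cond P \<Lambda> \<Delta> (restrict z \<Delta>) x) (Q \<Lambda> z x) < e"
  proof (eventually_elim, intro ballI)
    fix \<Delta> and z :: "'n site \<Rightarrow> 'a" assume \<Delta>: "finite \<Delta> \<and> D \<subseteq> \<Delta> \<and> \<Delta> \<subseteq> - \<Lambda>" and z: "z \<in> conf (- \<Lambda>)"
    have "Q \<Lambda> z x - e / 2 \<le> Q \<Lambda> w x \<and> Q \<Lambda> w x \<le> Q \<Lambda> z x + e / 2"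
      if "w \<in> conf (- \<Lambda>)" "\<forall>s\<in>\<Delta>. w s = z s" for w :: "'n site \<Rightarrow> 'a"
    proof -
      have "\<forall>s\<in>D. w s = z s" using that(2) \<Delta> by blast
      then show ?thesis using close[OF z that(1)] unfolding abs_le_iff by auto
    qed
    from fin_cond_between[OF rf sp ver \<Lambda> x _ _ this]
    have "Q \<Lambda> z x - e / 2 \<le> fin_cond P \<Lambda> \<Delta> (restrict z \<Delta>) x"
      "fin_cond P \<Lambda> \<Delta> (restrict z \<Delta>) x \<le> Q \<Lambda> z x + e / 2"
      using \<Delta> by auto
    then show "dist (fin_cond P \<Lambda> \<Delta> (restrict z \<Delta>) x) (Q \<Lambda> z x) < e"
      using \<open>e > 0\<close> by (simp add: dist_real_def abs_less_iff)
  qed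
qed


section \<open>Quasilocality of the one-point Gibbsian specification\<close>

lemma energy_singleton:
  "energy \<Phi> {t} z x = (\<Sum>\<^sub>\<infinity>K\<in>fin_subsets (- {t}). interaction \<Phi> {t} K x z)"
proof -
  have "Pow {t} - {{}} = {{t}}" by auto
  then show ?thesis by (simp add: energy_def)
qed

lemma interaction_cong:
  "(\<And>s. s \<in> K \<Longrightarrow> z s = w s) \<Longrightarrow> interaction \<Phi> J K x z = interaction \<Phi> J K x w"
  unfolding interaction_def by (metis restrict_ext)

text \<open>A finite partial sum that is uniformly within \<open>d\<close> of the energy, for all of
  the finitely many \<open>y\<close> at once, reads only the sites in the union of its index sets.
  Replacing the energy by it at both \<open>z\<close> and \<open>w\<close> costs
  \<open>2 * d\<close>.\<close>

lemma energy_singleton_osc: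
  fixes \<Phi> :: "('n::finite, 'a::finite) potential"
  assumes \<Phi>: "uniformly_convergent_potential \<Phi>" and d: "d > 0"
  shows "\<exists>D. finite D \<and> D \<subseteq> - {t} \<and> (\<forall>z\<in>conf (- {t}). \<forall>w\<in>conf (- {t}). (\<forall>s\<in>D. w s = z s) \<longrightarrow>
      (\<forall>y\<in>conf {t}. energy \<Phi> {t} w y \<le> energy \<Phi> {t} z y + 2 * d))"
proof -
  let ?S = "\<lambda>F y z. \<Sum>K\<in>F. interaction \<Phi> {t} K y z"
  have "\<forall>\<^sub>F F in finite_subsets_at_top (fin_subsets (- {t})). \<forall>z\<in>conf (- {t}).
      dist (?S F y z) (energy \<Phi> {t} z y) < d" if "y \<in> conf {t}" for y
    using \<Phi> that d unfolding uniformly_convergent_potential_def energy_singleton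
    by (intro uniform_limitD) auto
  then have "\<forall>\<^sub>F F in finite_subsets_at_top (fin_subsets (- {t})). \<forall>y\<in>conf {t}. \<forall>z\<in>conf (- {t}).
      dist (?S F y z) (energy \<Phi> {t} z y) < d"
    by (intro eventually_ball_finite finite_conf) auto
  then obtain F where F: "finite F" "F \<subseteq> fin_subsets (- {t})"
    and near: "\<And>y z. y \<in> conf {t} \<Longrightarrow> z \<in> conf (- {t}) \<Longrightarrow> dist (?S F y z) (energy \<Phi> {t} z y) < d"
    unfolding eventually_finite_subsets_at_top by (metis order_refl)
  have "energy \<Phi> {t} w y \<le> energy \<Phi> {t} z y + 2 * d"
    if "z \<in> conf (- {t})" "w \<in> conf (- {t})" "\<forall>s\<in>\<Union>F. w s = z s" "y \<in> conf {t}" for y z w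
  proof -
    have "?S F y w = ?S F y z" using that(3) by (intro sum.cong refl interaction_cong) auto
    then show ?thesis
      using near[OF that(4,1)] near[OF that(4,2)] unfolding dist_real_def by argo
  qed
  moreover have "finite (\<Union>F)" "\<Union>F \<subseteq> - {t}" using F by (auto simp: fin_subsets_def)
  ultimately show ?thesis by (intro exI[of _ "\<Union>F"]) blast
qed

text \<open>The Boltzmann weight and the normalizing sum each change by a factor of at most
  \<open>exp d\<close>, and in the worst case these factors multiply.\<close>

lemma gibbs_specification_le:
  fixes \<Phi> :: "('n::finite, 'a::finite) potential"
  assumes "finite \<Lambda>" "x \<in> conf \<Lambda>"
    and near: "\<And>y. y \<in> conf \<Lambda> \<Longrightarrow> energy \<Phi> \<Lambda> z y \<le> energy \<Phi> \<Lambda> w y + d \<and> energy \<Phi> \<Lambda> w y \<le> energy \<Phi> \<Lambda> z y + d"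
  shows "gibbs_specification \<Phi> \<Lambda> w x \<le> exp (2 * d) * gibbs_specification \<Phi> \<Lambda> z x"
proof -
  let ?Z = "\<lambda>z. \<Sum>y\<in>conf \<Lambda>. exp (- energy \<Phi> \<Lambda> z y)"
  have Z: "?Z z > 0" by (intro sum_pos finite_conf conf_nonempty assms(1)) simp
  have "exp (- d) * ?Z z \<le> ?Z w"
    unfolding sum_distrib_left
  proof (rule sum_mono)
    fix y :: "'n site \<Rightarrow> 'a" assume "y \<in> conf \<Lambda>"
    from near[OF this] show "exp (- d) * exp (- energy \<Phi> \<Lambda> z y) \<le> exp (- energy \<Phi> \<Lambda> w y)"
      by (simp flip: exp_add)
  qed
  moreover have "exp (- energy \<Phi> \<Lambda> w x) \<le> exp d * exp (- energy \<Phi> \<Lambda> z x)"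
    using near[OF assms(2)] by (simp flip: exp_add)
  ultimately have "exp (- energy \<Phi> \<Lambda> w x) / ?Z w \<le> exp d * exp (- energy \<Phi> \<Lambda> z x) / (exp (- d) * ?Z z)"
    using Z by (intro frac_le) auto
  also have "\<dots> = exp (2 * d) * (exp (- energy \<Phi> \<Lambda> z x) / ?Z z)"
    using Z by (simp add: exp_minus field_simps flip: exp_add)
  finally show ?thesis by (simp add: gibbs_specification_def)
qed

lemma gibbs_specification_le_1:
  assumes "finite \<Lambda>" "x \<in> conf \<Lambda>"
  shows "gibbs_specification \<Phi> \<Lambda> z x \<le> 1"
proof -
  have "exp (- energy \<Phi> \<Lambda> z x) \<le> (\<Sum>y\<in>conf \<Lambda>. exp (- energy \<Phi> \<Lambda> z y))"
    using assms by (intro member_le_sum) (auto simp: finite_conf)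
  moreover have "0 < exp (- energy \<Phi> \<Lambda> z x)" by simp
  ultimately show ?thesis
    unfolding gibbs_specification_def by (subst divide_le_eq_1_pos) linarith+
qed

lemma gibbs_specification_singleton_osc:
  fixes \<Phi> :: "('n::finite, 'a::finite) potential"
  assumes \<Phi>: "uniformly_convergent_potential \<Phi>" and x: "x \<in> conf {t}" and e: "e > 0"
  shows "\<exists>D. finite D \<and> D \<subseteq> - {t} \<and> (\<forall>z\<in>conf (- {t}). \<forall>w\<in>conf (- {t}). (\<forall>s\<in>D. w s = z s) \<longrightarrow>
      \<bar>gibbs_specification \<Phi> {t} w x - gibbs_specification \<Phi> {t} z x\<bar> \<le> e)"
proof -
  \<comment> \<open>The energies move by at most \<open>2 * d\<close>, hence the specification by a
    factor of at most \<open>exp (2 * (2 * d)) = 1 + e\<close>. As its values do not exceed 1, the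
    additive error is at most \<open>e\<close>.\<close>
  define d where "d = ln (1 + e) / 4"
  have d: "d > 0" "exp (2 * (2 * d)) = 1 + e" using e by (simp_all add: d_def)
  obtain D where D: "finite D" "D \<subseteq> - {t}"
    and near: "\<And>z w y. z \<in> conf (- {t}) \<Longrightarrow> w \<in> conf (- {t}) \<Longrightarrow> \<forall>s\<in>D. w s = z s \<Longrightarrow> y \<in> conf {t} \<Longrightarrow>
      energy \<Phi> {t} w y \<le> energy \<Phi> {t} z y + 2 * d"
    using energy_singleton_osc[OF \<Phi> d(1), of t] by metis
  have le: "gibbs_specification \<Phi> {t} w x \<le> gibbs_specification \<Phi> {t} z x + e"
    if zw: "z \<in> conf (- {t})" "w \<in> conf (- {t})" "\<forall>s\<in>D. w s = z s" for z w
  proof -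
    have zw': "\<forall>s\<in>D. z s = w s" using zw(3) by simp
    have "gibbs_specification \<Phi> {t} w x \<le> (1 + e) * gibbs_specification \<Phi> {t} z x"
      unfolding d(2)[symmetric] using near[OF zw] near[OF zw(2,1) zw']
      by (intro gibbs_specification_le x) auto
    moreover have "e * gibbs_specification \<Phi> {t} z x \<le> e * 1"
      using e x by (intro mult_left_mono gibbs_specification_le_1) auto
    ultimately show ?thesis by (simp add: distrib_right)
  qed
  have "\<bar>gibbs_specification \<Phi> {t} w x - gibbs_specification \<Phi> {t} z x\<bar> \<le> e"
    if zw: "z \<in> conf (- {t})" "w \<in> conf (- {t})" "\<forall>s\<in>D. w s = z s" for z w
  proof -
    have "\<forall>s\<in>D. z s = w s" using zw(3) by simp
    then show ?thesis using le[OF zw] le[OF zw(2,1)] by (simp add: abs_le_iff)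
  qed
  with D show ?thesis by blast
qed

text \<open>The limits are the values of the one-point Gibbsian specification, which are positive as
  quotients of exponentials.\<close>

lemma gibbs_imp_strictly_positive_and_positive_limits:
  fixes P :: "('n::finite site \<Rightarrow> 'a::finite) measure"
  assumes "gibbs_random_field P"
  shows "strictly_positive P" and "positive_limits (one_point_fin_cond P)"
proof -
  obtain \<Phi> where rf: "random_field P" and \<Phi>: "uniformly_convergent_potential \<Phi>"
    and ver: "version_of_cond_distr P (gibbs_specification \<Phi>)"
    using assms unfolding gibbs_random_field_def by blast
  show sp: "strictly_positive P"
    by (rule positive_version_imp_strictly_positive[OF rf ver gibbs_specification_pos])
  show "positive_limits (one_point_fin_cond P)"
    unfolding positive_limits_def one_point_fin_cond_def
  proof (intro allI ballI)
    fix t and x :: "'n site \<Rightarrow> 'a" assume x: "x \<in> conf {t}"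
    let ?l = "\<lambda>z. gibbs_specification \<Phi> {t} z x"
    have lim: "uniform_limit (conf (- {t})) (\<lambda>\<Delta> z. fin_cond P {t} \<Delta> (restrict z \<Delta>) x) ?l
        (finite_subsets_at_top (- {t}))"
      by (rule uniform_limit_fin_cond[OF rf sp ver _ x gibbs_specification_singleton_osc[OF \<Phi> x]]) simp_all
    moreover have "\<forall>z\<in>conf (- {t}).
        ((\<lambda>\<Delta>. fin_cond P {t} \<Delta> (restrict z \<Delta>) x) \<longlongrightarrow> ?l z) (finite_subsets_at_top (- {t}))"
      using tendsto_uniform_limitI[OF lim] by simp
    moreover have "\<forall>z\<in>conf (- {t}). 0 < ?l z" by (simp add: gibbs_specification_pos)
    ultimately show "\<exists>l. (\<forall>z\<in>conf (- {t}).
          ((\<lambda>\<Delta>. fin_cond P {t} \<Delta> (restrict z \<Delta>) x) \<longlongrightarrow> l z) (finite_subsets_at_top (- {t}))) \<and>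
        (\<forall>z\<in>conf (- {t}). 0 < l z) \<and>
        uniform_limit (conf (- {t})) (\<lambda>\<Delta> z. fin_cond P {t} \<Delta> (restrict z \<Delta>) x) l
          (finite_subsets_at_top (- {t}))"
      by (intro exI[of _ ?l] conjI)
  qed
qed

section \<open>Logarithms of cylinder probabilities\<close>

definition log_prob ::
  "('n::finite site \<Rightarrow> 'a::finite) measure \<Rightarrow> 'n site set \<Rightarrow> ('n site \<Rightarrow> 'a) \<Rightarrow> real" where
  "log_prob P \<Delta> \<omega> = ln (cyl_prob P \<Delta> \<omega>)"

lemma abs_ln_diff_le:
  fixes x y c :: real
  assumes "0 < c" "c \<le> x" "c \<le> y"
  shows "\<bar>ln x - ln y\<bar> \<le> \<bar>x - y\<bar> / c"
proof -
  have *: "ln u - ln v \<le> \<bar>u - v\<bar> / c" if "c \<le> u" "c \<le> v" for u v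
  proof -
    have "ln u - ln v \<le> (u - v) / v" using that assms(1) by (intro ln_diff_le) auto
    also have "\<dots> \<le> \<bar>u - v\<bar> / v" using that assms(1) by (intro divide_right_mono) auto
    also have "\<dots> \<le> \<bar>u - v\<bar> / c" using that assms(1) by (intro divide_left_mono) auto
    finally show ?thesis .
  qed
  show ?thesis using *[OF assms(2,3)] *[OF assms(3,2)] by (simp add: abs_le_iff abs_minus_commute)
qed

text \<open>The bound on the limit keeps the approximations eventually above \<open>c / 2\<close>,
  where the logarithm is Lipschitz. This is where uniform nonnullness enters.\<close>

lemma uniform_limit_ln:
  fixes f :: "'b \<Rightarrow> 'c \<Rightarrow> real"
  assumes lim: "uniform_limit X f l F" and c: "c > 0" "\<And>x. x \<in> X \<Longrightarrow> c \<le> l x"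
  shows "uniform_limit X (\<lambda>n x. ln (f n x)) (\<lambda>x. ln (l x)) F"
proof (rule uniform_limitI)
  fix e :: real assume e: "e > 0"
  \<comment> \<open>The first term of the minimum keeps \<open>f n x\<close> above
    \<open>c / 2\<close>; the second compensates the Lipschitz constant
    \<open>2 / c\<close>.\<close>
  define d where "d = min (c / 2) (e * (c / 2))"
  have "d > 0" using e c(1) by (simp add: d_def)
  from uniform_limitD[OF lim this]
  show "\<forall>\<^sub>F n in F. \<forall>x\<in>X. dist (ln (f n x)) (ln (l x)) < e"
  proof (eventually_elim, intro ballI)
    fix n x assume "\<forall>x\<in>X. dist (f n x) (l x) < d" and x: "x \<in> X"
    then have near: "\<bar>f n x - l x\<bar> < d" by (simp add: dist_real_def)
    have "d \<le> c / 2" by (simp add: d_def)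
    then have "c / 2 \<le> f n x" "c / 2 \<le> l x" using near c(2)[OF x] c(1) by linarith+
    then have "\<bar>ln (f n x) - ln (l x)\<bar> \<le> \<bar>f n x - l x\<bar> / (c / 2)"
      using c(1) by (intro abs_ln_diff_le) auto
    also have "\<dots> < d / (c / 2)" using near c(1) by (intro divide_strict_right_mono) auto
    also have "\<dots> \<le> e" using c(1) by (subst pos_divide_le_eq) (auto simp: d_def)
    finally show "dist (ln (f n x)) (ln (l x)) < e" by (simp add: dist_real_def)
  qed
qed

text \<open>As soon as \<open>\<Delta>\<close> contains \<open>t\<close>, the difference is the
  logarithm of the one-point conditional probability of \<open>a\<close> given
  \<open>\<omega>\<close> on \<open>\<Delta> - {t}\<close>.\<close>

lemma uniform_limit_log_prob_extend:
  fixes P :: "('n::finite site \<Rightarrow> 'a::finite) measure"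
  assumes rf: "random_field P" and sp: "strictly_positive P"
    and nn: "uniformly_nonnull_limits (one_point_fin_cond P)"
  shows "\<exists>M. uniform_limit UNIV (\<lambda>\<Delta> \<omega>. log_prob P \<Delta> (fun_upd \<omega> t a) - log_prob P (\<Delta> - {t}) \<omega>) M
    (finite_subsets_at_top UNIV)"
proof -
  let ?x = "\<lambda>s\<in>{t}. a"
  have "?x \<in> conf {t}" by simp
  from bspec[OF spec[OF nn[unfolded uniformly_nonnull_limits_def one_point_fin_cond_def]] this]
  obtain l c where "c > 0" "\<forall>z\<in>conf (- {t}). c \<le> l z"
    and lim: "uniform_limit (conf (- {t})) (\<lambda>\<Delta> z. fin_cond P {t} \<Delta> (restrict z \<Delta>) ?x) l
      (finite_subsets_at_top (- {t}))"
    by (elim exE conjE) (rule that)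
  then have c: "c > 0" "\<And>z. z \<in> conf (- {t}) \<Longrightarrow> c \<le> l z" by simp_all
  let ?M = "\<lambda>\<omega>. ln (l (restrict \<omega> (- {t})))"
  have "uniform_limit UNIV (\<lambda>\<Delta> \<omega>. log_prob P \<Delta> (fun_upd \<omega> t a) - log_prob P (\<Delta> - {t}) \<omega>) ?M
    (finite_subsets_at_top UNIV)"
  proof (rule uniform_limitI)
    fix e :: real assume e: "e > 0"
    have "\<forall>\<^sub>F \<Delta> in finite_subsets_at_top UNIV. \<forall>z\<in>conf (- {t}).
        dist (ln (fin_cond P {t} (\<Delta> - {t}) (restrict z (\<Delta> - {t})) ?x)) (ln (l z)) < e"
      using uniform_limitD[OF uniform_limit_ln[OF lim c] e]
      by (rule eventually_compose_filterlim[OF _ filterlim_Diff_finite_subsets_at_top]) simp_all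
    moreover have "\<forall>\<^sub>F \<Delta> in finite_subsets_at_top UNIV. finite \<Delta> \<and> {t} \<subseteq> \<Delta> \<and> \<Delta> \<subseteq> UNIV"
      by (rule eventually_finite_superset) auto
    ultimately show "\<forall>\<^sub>F \<Delta> in finite_subsets_at_top UNIV. \<forall>\<omega>\<in>UNIV.
        dist (log_prob P \<Delta> (fun_upd \<omega> t a) - log_prob P (\<Delta> - {t}) \<omega>) (?M \<omega>) < e"
    proof (eventually_elim, intro ballI)
      fix \<Delta> and \<omega> :: "'n site \<Rightarrow> 'a"
      assume near: "\<forall>z\<in>conf (- {t}).
          dist (ln (fin_cond P {t} (\<Delta> - {t}) (restrict z (\<Delta> - {t})) ?x)) (ln (l z)) < e"
        and \<Delta>: "finite \<Delta> \<and> {t} \<subseteq> \<Delta> \<and> \<Delta> \<subseteq> UNIV"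
      let ?z = "restrict \<omega> (- {t})"
      have "fin_cond P {t} (\<Delta> - {t}) (restrict ?z (\<Delta> - {t})) ?x =
          cyl_prob P ({t} \<union> (\<Delta> - {t})) (glue {t} ?x ?z) / cyl_prob P (\<Delta> - {t}) ?z"
        using \<Delta> by (intro fin_cond_eq_cyl_prob[OF rf]) auto
      also have "{t} \<union> (\<Delta> - {t}) = \<Delta>" using \<Delta> by auto
      also have "cyl_prob P \<Delta> (glue {t} ?x ?z) = cyl_prob P \<Delta> (fun_upd \<omega> t a)"
        by (intro cyl_prob_cong) (auto simp: merge_def)
      also have "cyl_prob P (\<Delta> - {t}) ?z = cyl_prob P (\<Delta> - {t}) \<omega>"
        by (intro cyl_prob_restrict) auto
      finally have eq: "fin_cond P {t} (\<Delta> - {t}) (restrict ?z (\<Delta> - {t})) ?x =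
          cyl_prob P \<Delta> (fun_upd \<omega> t a) / cyl_prob P (\<Delta> - {t}) \<omega>" .
      have "cyl_prob P \<Delta> (fun_upd \<omega> t a) > 0" "cyl_prob P (\<Delta> - {t}) \<omega> > 0"
        using sp \<Delta> by (simp_all add: strictly_positive_iff_cyl_prob[OF rf])
      then have "ln (fin_cond P {t} (\<Delta> - {t}) (restrict ?z (\<Delta> - {t})) ?x) =
          log_prob P \<Delta> (fun_upd \<omega> t a) - log_prob P (\<Delta> - {t}) \<omega>"
        unfolding eq log_prob_def by (simp only: ln_div) simp
      with bspec[OF near restrict_in_conf, of \<omega>]
      show "dist (log_prob P \<Delta> (fun_upd \<omega> t a) - log_prob P (\<Delta> - {t}) \<omega>) (?M \<omega>) < e" by simp
    qed
  qed
  then show ?thesis by blast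
qed

text \<open>The difference of two extensions from \<open>\<Delta> - {t}\<close>, by the states
  \<open>\<omega> t\<close> and \<open>b\<close>; the common term cancels.\<close>

lemma uniform_limit_log_prob_update:
  fixes P :: "('n::finite site \<Rightarrow> 'a::finite) measure"
  assumes rf: "random_field P" and sp: "strictly_positive P"
    and nn: "uniformly_nonnull_limits (one_point_fin_cond P)"
  shows "\<exists>M. uniform_limit UNIV (\<lambda>\<Delta> \<omega>. log_prob P \<Delta> \<omega> - log_prob P \<Delta> (fun_upd \<omega> t b)) M
    (finite_subsets_at_top UNIV)"
proof -
  let ?g = "\<lambda>a \<Delta> \<omega>. log_prob P \<Delta> (fun_upd \<omega> t a) - log_prob P (\<Delta> - {t}) \<omega>"
  have "\<forall>a. \<exists>M. uniform_limit UNIV (?g a) M (finite_subsets_at_top UNIV)"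
    using uniform_limit_log_prob_extend[OF assms] by blast
  from choice[OF this]
  obtain M where M: "\<And>a. uniform_limit UNIV (?g a) (M a) (finite_subsets_at_top UNIV)" by blast
  have "uniform_limit UNIV (\<lambda>\<Delta> \<omega>. log_prob P \<Delta> \<omega> - log_prob P \<Delta> (fun_upd \<omega> t b))
    (\<lambda>\<omega>. M (\<omega> t) \<omega> - M b \<omega>) (finite_subsets_at_top UNIV)"
  proof (rule uniform_limitI)
    fix e :: real assume "e > 0"
    then have "\<forall>\<^sub>F \<Delta> in finite_subsets_at_top UNIV. \<forall>\<omega>\<in>UNIV. dist (?g a \<Delta> \<omega>) (M a \<omega>) < e / 2" for a
      by (intro uniform_limitD[OF M]) simp
    \<comment> \<open>The state \<open>\<omega> t\<close> varies with \<open>\<omega>\<close>, so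
      the estimate must hold for all states at once; there are finitely many.\<close>
    then have "\<forall>\<^sub>F \<Delta> in finite_subsets_at_top UNIV. \<forall>a. \<forall>\<omega>\<in>UNIV. dist (?g a \<Delta> \<omega>) (M a \<omega>) < e / 2"
      by (rule eventually_all_finite)
    then show "\<forall>\<^sub>F \<Delta> in finite_subsets_at_top UNIV. \<forall>\<omega>\<in>UNIV.
        dist (log_prob P \<Delta> \<omega> - log_prob P \<Delta> (fun_upd \<omega> t b)) (M (\<omega> t) \<omega> - M b \<omega>) < e"
    proof (eventually_elim, intro ballI)
      fix \<Delta> and \<omega> :: "'n site \<Rightarrow> 'a"
      assume *: "\<forall>a. \<forall>\<omega>\<in>UNIV. dist (?g a \<Delta> \<omega>) (M a \<omega>) < e / 2"
      have "dist (?g (\<omega> t) \<Delta> \<omega>) (M (\<omega> t) \<omega>) < e / 2" "dist (?g b \<Delta> \<omega>) (M b \<omega>) < e / 2"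
        using * by blast+
      then show "dist (log_prob P \<Delta> \<omega> - log_prob P \<Delta> (fun_upd \<omega> t b)) (M (\<omega> t) \<omega> - M b \<omega>) < e"
        unfolding dist_real_def fun_upd_triv by argo
    qed
  qed
  then show ?thesis by blast
qed

text \<open>
  The vacuum is \<open>undefined\<close>, so that \<open>restrict \<omega> S\<close> is \<open>\<omega>\<close> on \<open>S\<close> and the vacuum elsewhere.
\<close>

definition log_prob_step ::
  "('n::finite site \<Rightarrow> 'a::finite) measure \<Rightarrow> nat \<Rightarrow> 'n site set \<Rightarrow> ('n site \<Rightarrow> 'a) \<Rightarrow> real" where
  "log_prob_step P i \<Delta> \<omega> =
    log_prob P \<Delta> (restrict \<omega> (- initial_sites i)) - log_prob P \<Delta> (restrict \<omega> (- initial_sites (Suc i)))"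

text \<open>Step \<open>i\<close> turns exactly one site, the one of index \<open>i\<close>, into
  the vacuum, so it is a one-site update applied to a truncated configuration.\<close>

lemma uniform_limit_log_prob_step:
  fixes P :: "('n::finite site \<Rightarrow> 'a::finite) measure"
  assumes rf: "random_field P" and sp: "strictly_positive P"
    and nn: "uniformly_nonnull_limits (one_point_fin_cond P)"
  shows "\<exists>f. uniform_limit UNIV (log_prob_step P i) f (finite_subsets_at_top UNIV)"
proof -
  obtain t :: "'n site" where t: "site_index t = i"
    using bij_is_surj[OF bij_site_index] by (metis surjD)
  obtain M where M: "uniform_limit UNIV
      (\<lambda>\<Delta> \<omega>. log_prob P \<Delta> \<omega> - log_prob P \<Delta> (fun_upd \<omega> t undefined)) M (finite_subsets_at_top UNIV)"
    using uniform_limit_log_prob_update[OF assms] by blast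
  have eq: "restrict \<omega> (- initial_sites (Suc i)) = fun_upd (restrict \<omega> (- initial_sites i)) t undefined"
    for \<omega> :: "'n site \<Rightarrow> 'a"
  proof
    fix s
    have "site_index s = i \<longleftrightarrow> s = t"
      using t bij_is_inj[OF bij_site_index] by (metis injD)
    then show "restrict \<omega> (- initial_sites (Suc i)) s = fun_upd (restrict \<omega> (- initial_sites i)) t undefined s"
      by (auto simp: initial_sites_def)
  qed
  have "uniform_limit UNIV (log_prob_step P i) (\<lambda>\<omega>. M (restrict \<omega> (- initial_sites i)))
      (finite_subsets_at_top UNIV)"
    unfolding log_prob_step_def[abs_def] eq by (rule uniform_limit_compose'[OF M]) simp
  then show ?thesis by blast
qed

text \<open>The subtracted term depends only on \<open>\<omega>\<close> outside
  \<open>initial_sites n\<close>, so it cancels when configurations that agree there are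
  compared.\<close>

lemma sum_log_prob_step:
  "(\<Sum>i<n. log_prob_step P i \<Delta> \<omega>) = log_prob P \<Delta> \<omega> - log_prob P \<Delta> (restrict \<omega> (- initial_sites n))"
proof -
  have "restrict \<omega> (- initial_sites 0) = \<omega>" by (auto simp: initial_sites_def)
  then show ?thesis
    unfolding log_prob_step_def
    using sum_lessThan_telescope'[of "\<lambda>i. log_prob P \<Delta> (restrict \<omega> (- initial_sites i))" n] by simp
qed

lemma log_prob_cong: "(\<And>s. s \<in> \<Delta> \<Longrightarrow> \<omega> s = \<omega>' s) \<Longrightarrow> log_prob P \<Delta> \<omega> = log_prob P \<Delta> \<omega>'"
  unfolding log_prob_def by (simp cong: cyl_prob_cong)

text \<open>Step \<open>i\<close> reads only sites from the \<open>i\<close>-th on, and its two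
  terms coincide if all of these carry the vacuum; both facts pass to the limit. The third follows
  from uniform approximation by a function of finitely many sites.\<close>

lemma log_prob_step_limit:
  fixes f :: "('n::finite site \<Rightarrow> 'a::finite) \<Rightarrow> real"
  assumes lim: "uniform_limit UNIV (log_prob_step P i) f (finite_subsets_at_top UNIV)"
  shows log_prob_step_limit_local:
      "\<And>\<omega> \<omega>'. (\<And>s. i \<le> site_index s \<Longrightarrow> \<omega> s = \<omega>' s) \<Longrightarrow> f \<omega> = f \<omega>'"
    and log_prob_step_limit_vacuum: "\<And>\<omega>. f (restrict \<omega> (initial_sites i)) = 0"
    and log_prob_step_limit_approx:
      "\<And>e. e > 0 \<Longrightarrow> \<exists>n. \<forall>m\<ge>n. \<forall>\<omega>. \<bar>f \<omega> - f (restrict \<omega> (initial_sites m))\<bar> \<le> e"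
proof -
  have tendsto: "((\<lambda>\<Delta>. log_prob_step P i \<Delta> \<omega>) \<longlongrightarrow> f \<omega>) (finite_subsets_at_top UNIV)" for \<omega>
    by (rule tendsto_uniform_limitI[OF lim]) simp
  show "f \<omega> = f \<omega>'" if "\<And>s. i \<le> site_index s \<Longrightarrow> \<omega> s = \<omega>' s" for \<omega> \<omega>'
  proof -
    have "restrict \<omega> (- initial_sites i) = restrict \<omega>' (- initial_sites i)"
      "restrict \<omega> (- initial_sites (Suc i)) = restrict \<omega>' (- initial_sites (Suc i))"
      using that by (auto simp: initial_sites_def restrict_def)
    then have "log_prob_step P i \<Delta> \<omega> = log_prob_step P i \<Delta> \<omega>'" for \<Delta>
      by (simp only: log_prob_step_def)
    then show ?thesis using tendsto[of \<omega>] tendsto[of \<omega>']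
      by (intro tendsto_unique[OF finite_subsets_at_top_neq_bot]) simp_all
  qed
  show "f (restrict \<omega> (initial_sites i)) = 0" for \<omega>
  proof -
    have "restrict (restrict \<omega> (initial_sites i)) (- initial_sites i) = (\<lambda>_. undefined)"
      "restrict (restrict \<omega> (initial_sites i)) (- initial_sites (Suc i)) = (\<lambda>_. undefined)"
      by (auto simp: initial_sites_def restrict_def)
    then have "log_prob_step P i \<Delta> (restrict \<omega> (initial_sites i)) = 0" for \<Delta>
      by (simp only: log_prob_step_def)
    then show ?thesis using tendsto[of "restrict \<omega> (initial_sites i)"]
      by (simp add: tendsto_const_iff)
  qed
  show "\<exists>n. \<forall>m\<ge>n. \<forall>\<omega>. \<bar>f \<omega> - f (restrict \<omega> (initial_sites m))\<bar> \<le> e" if "e > 0" for e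
  proof -
    have "\<forall>\<^sub>F \<Delta> in finite_subsets_at_top UNIV. \<forall>\<omega>\<in>UNIV. dist (log_prob_step P i \<Delta> \<omega>) (f \<omega>) < e / 2"
      using that by (intro uniform_limitD[OF lim]) simp
    then obtain \<Delta> where \<Delta>: "finite \<Delta>" and near: "\<And>\<omega>. dist (log_prob_step P i \<Delta> \<omega>) (f \<omega>) < e / 2"
      unfolding eventually_finite_subsets_at_top by (metis order_refl UNIV_I subset_UNIV)
    obtain n where n: "\<Delta> \<subseteq> initial_sites n" using finite_subset_initial_sites[OF \<Delta>] by blast
    have "\<bar>f \<omega> - f (restrict \<omega> (initial_sites m))\<bar> \<le> e" if m: "m \<ge> n" for m \<omega>
    proof -
      let ?\<omega> = "restrict \<omega> (initial_sites m)"
      have "\<Delta> \<subseteq> initial_sites m" using n initial_sites_mono[OF m] by blast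
      \<comment> \<open>The truncation to \<open>initial_sites m\<close> changes nothing on
        \<open>\<Delta>\<close>, so \<open>f i\<close> at both configurations is within
        \<open>e / 2\<close> of the same number.\<close>
      then have "log_prob P \<Delta> (restrict ?\<omega> S) = log_prob P \<Delta> (restrict \<omega> S)" for S
        by (intro log_prob_cong) (auto simp: restrict_def)
      then have "log_prob_step P i \<Delta> ?\<omega> = log_prob_step P i \<Delta> \<omega>"
        by (simp only: log_prob_step_def)
      then show ?thesis using near[of \<omega>] near[of ?\<omega>] unfolding dist_real_def by argo
    qed
    then show ?thesis by blast
  qed
qed

section \<open>The potential\<close>

text \<open>Levels are chosen one after the other, each beyond the last and large enough for a
  geometric error. Level 0 is pinned to \<open>i\<close> and carries no error bound: there the
  truncated \<open>f i\<close> is exactly 0.\<close>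

lemma fast_approximation_levels:
  fixes a :: "nat \<Rightarrow> 'b \<Rightarrow> real"
  assumes "\<And>e. e > 0 \<Longrightarrow> \<exists>n. \<forall>m\<ge>n. \<forall>\<omega>. \<bar>a m \<omega>\<bar> \<le> e"
  shows "\<exists>N. N 0 = (i::nat) \<and> strict_mono N \<and> (\<forall>k>0. \<forall>\<omega>. \<bar>a (N k) \<omega>\<bar> \<le> (1/2) ^ k)"
proof -
  define good where "good k n \<longleftrightarrow> (if k = 0 then n = i else \<forall>\<omega>. \<bar>a n \<omega>\<bar> \<le> (1/2) ^ k)" for k n
  have "\<exists>N. \<forall>k. good k (N k) \<and> N k < N (Suc k)"
  proof (rule dependent_nat_choice)
    show "\<exists>n. good 0 n" by (simp add: good_def)
  next
    fix n k
    obtain n' where n': "\<And>m \<omega>. m \<ge> n' \<Longrightarrow> \<bar>a m \<omega>\<bar> \<le> (1/2) ^ Suc k"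
      using assms[of "(1/2) ^ Suc k"] by auto
    have "good (Suc k) (max n' (Suc n))"
      unfolding good_def using n'[of "max n' (Suc n)"] by simp
    then show "\<exists>m. good (Suc k) m \<and> n < m" by (intro exI[of _ "max n' (Suc n)"]) auto
  qed
  then obtain N where N: "\<And>k. good k (N k)" "\<And>k. N k < N (Suc k)" by blast
  have "N 0 = i" using N(1)[of 0] by (simp add: good_def)
  moreover have "strict_mono N" using N(2) by (simp add: strict_mono_Suc_iff)
  moreover have "\<forall>k>0. \<forall>\<omega>. \<bar>a (N k) \<omega>\<bar> \<le> (1/2) ^ k"
    using N(1) unfolding good_def by (metis less_numeral_extra(3))
  ultimately show ?thesis by blast
qed

section \<open>The energy as a single unordered sum over supports\<close>

lemma interaction_eq_real_of_ereal:
  assumes "J \<subseteq> \<Lambda>" "K \<subseteq> - \<Lambda>"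
  shows "interaction \<Phi> J K x z = real_of_ereal (\<Phi> (J \<union> K) (restrict (glue \<Lambda> x z) (J \<union> K)))"
proof -
  have "merge J K (restrict x J, restrict z K) = restrict (glue \<Lambda> x z) (J \<union> K)"
    using assms by (intro ext) (auto simp: merge_def restrict_def)
  then show ?thesis by (simp add: interaction_def)
qed

definition touching :: "'n::finite site set \<Rightarrow> 'n site set set" where
  "touching \<Lambda> = {A. finite A \<and> A \<inter> \<Lambda> \<noteq> {}}"

lemma bij_betw_Un_touching:
  assumes "finite \<Lambda>"
  shows "bij_betw (\<lambda>(J, K). J \<union> K) ((Pow \<Lambda> - {{}}) \<times> fin_subsets (- \<Lambda>)) (touching \<Lambda>)"
  by (rule bij_betwI[where g = "\<lambda>A. (A \<inter> \<Lambda>, A - \<Lambda>)"])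
    (use assms in \<open>auto simp: touching_def fin_subsets_def intro: finite_subset\<close>)

text \<open>A finite set \<open>A\<close> meeting \<open>\<Lambda>\<close> splits uniquely into
  \<open>A \<inter> \<Lambda>\<close> and \<open>A - \<Lambda>\<close>, and unordered summability
  allows the sum over \<open>A\<close> to be iterated.\<close>

lemma energy_eq_infsum_touching:
  fixes \<Phi> :: "('n::finite, 'a::finite) potential"
  assumes \<Lambda>: "finite \<Lambda>"
    and sum: "(\<lambda>A. real_of_ereal (\<Phi> A (restrict (glue \<Lambda> x z) A))) summable_on touching \<Lambda>"
  shows "energy \<Phi> \<Lambda> z x = (\<Sum>\<^sub>\<infinity>A\<in>touching \<Lambda>. real_of_ereal (\<Phi> A (restrict (glue \<Lambda> x z) A)))"
proof -
  let ?\<phi> = "\<lambda>A. real_of_ereal (\<Phi> A (restrict (glue \<Lambda> x z) A))"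
  let ?I = "(Pow \<Lambda> - {{}}) \<times> fin_subsets (- \<Lambda>)"
  note bij = bij_betw_Un_touching[OF \<Lambda>]
  have "(\<lambda>p. ?\<phi> (case p of (J, K) \<Rightarrow> J \<union> K)) summable_on ?I"
    using sum by (subst summable_on_reindex_bij_betw[OF bij])
  then have summable: "(\<lambda>(J, K). ?\<phi> (J \<union> K)) summable_on ?I"
    by (simp add: case_prod_unfold)
  have "(\<Sum>\<^sub>\<infinity>A\<in>touching \<Lambda>. ?\<phi> A) = (\<Sum>\<^sub>\<infinity>p\<in>?I. ?\<phi> (case p of (J, K) \<Rightarrow> J \<union> K))"
    by (rule infsum_reindex_bij_betw[OF bij, symmetric])
  also have "\<dots> = (\<Sum>\<^sub>\<infinity>(J, K)\<in>?I. ?\<phi> (J \<union> K))"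
    by (simp add: case_prod_unfold)
  also have "\<dots> = (\<Sum>\<^sub>\<infinity>J\<in>Pow \<Lambda> - {{}}. \<Sum>\<^sub>\<infinity>K\<in>fin_subsets (- \<Lambda>). ?\<phi> (J \<union> K))"
    by (rule infsum_Sigma'_banach[OF summable, symmetric])
  also have "\<dots> = (\<Sum>J\<in>Pow \<Lambda> - {{}}. \<Sum>\<^sub>\<infinity>K\<in>fin_subsets (- \<Lambda>). ?\<phi> (J \<union> K))"
    using \<Lambda> by (intro infsum_finite) simp
  also have "\<dots> = energy \<Phi> \<Lambda> z x"
    unfolding energy_def
    by (intro sum.cong refl infsum_cong interaction_eq_real_of_ereal[symmetric])
      (auto simp: fin_subsets_def)
  finally show ?thesis by simp
qed

text \<open>The Weierstrass M-test with a majorant depending on the support alone.\<close>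

lemma uniformly_convergent_potentialI:
  fixes \<Phi> :: "('n::finite, 'a::finite) potential"
  assumes fin: "\<And>A x. \<bar>\<Phi> A x\<bar> \<noteq> \<infinity>"
    and bound: "\<And>A x. \<bar>real_of_ereal (\<Phi> A x)\<bar> \<le> m A"
    and sum: "\<And>t. m summable_on touching {t}"
  shows "uniformly_convergent_potential \<Phi>"
proof -
  have sum': "(\<lambda>K. m ({t} \<union> K)) summable_on fin_subsets (- {t})" for t
  proof -
    have inj: "inj_on (\<lambda>K. {t} \<union> K) (fin_subsets (- {t}))"
      by (rule inj_onI) (auto simp: fin_subsets_def)
    have "m summable_on (\<lambda>K. {t} \<union> K) ` fin_subsets (- {t})"
      by (rule summable_on_subset_banach[OF sum[of t]]) (auto simp: touching_def fin_subsets_def)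
    then show ?thesis by (simp only: summable_on_reindex[OF inj] o_def)
  qed
  have le: "norm (interaction \<Phi> {t} K x z) \<le> m ({t} \<union> K)" for t K x z
    using bound by (simp add: interaction_def)
  have "(\<lambda>K. interaction \<Phi> {t} K x z) summable_on fin_subsets (- {t})" for t x z
    by (rule abs_summable_summable, rule Infinite_Sum.abs_summable_on_comparison_test'[OF sum'], rule le)
  moreover have "uniform_limit (conf (-{t})) (\<lambda>F z. \<Sum>K\<in>F. interaction \<Phi> {t} K x z)
          (\<lambda>z. \<Sum>\<^sub>\<infinity>K\<in>fin_subsets (-{t}). interaction \<Phi> {t} K x z)
          (finite_subsets_at_top (fin_subsets (-{t})))" for t x
    by (rule Weierstrass_m_test_general[OF _ sum']) (rule le)
  moreover have "\<Phi> A x \<noteq> - \<infinity>" for A x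
    using fin[of A x] by auto
  then have "is_potential \<Phi>" "real_potential \<Phi>"
    unfolding is_potential_def real_potential_def using fin by simp_all
  ultimately show ?thesis
    unfolding uniformly_convergent_potential_def convergent_potential_def by blast
qed

section \<open>Telescoping one-sided quasilocal functions into a potential\<close>

text \<open>Collects what the construction uses of the limits \<open>f i\<close>, without reference
  to a measure. By \<open>N_0\<close> and \<open>f_vacuum\<close> the telescoping of
  \<open>f i\<close> along the levels \<open>N i k\<close> starts from the value 0.\<close>

locale telescoping_potential =
  fixes f :: "nat \<Rightarrow> ('n::finite site \<Rightarrow> 'a::finite) \<Rightarrow> real" and N :: "nat \<Rightarrow> nat \<Rightarrow> nat"
  assumes f_local: "\<And>i \<omega> \<omega>'. (\<And>s. i \<le> site_index s \<Longrightarrow> \<omega> s = \<omega>' s) \<Longrightarrow> f i \<omega> = f i \<omega>'"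
    and f_vacuum: "\<And>i \<omega>. f i (restrict \<omega> (initial_sites i)) = 0"
    and N_0: "\<And>i. N i 0 = i"
    and N_mono: "\<And>i. strict_mono (N i)"
    and f_approx: "\<And>i k \<omega>. k > 0 \<Longrightarrow> \<bar>f i \<omega> - f i (restrict \<omega> (initial_sites (N i k)))\<bar> \<le> (1/2) ^ k"
begin

definition increment :: "nat \<times> nat \<Rightarrow> ('n site \<Rightarrow> 'a) \<Rightarrow> real" where
  "increment = (\<lambda>(i, k) \<omega>. f i (restrict \<omega> (initial_sites (N i (Suc k)))) - f i (restrict \<omega> (initial_sites (N i k))))"

text \<open>The support of the increment, an interval of the enumeration: \<open>f i\<close> ignores
  the sites before the \<open>i\<close>-th, and both truncations ignore those from
  \<open>N i (Suc k)\<close> on.\<close>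

definition block :: "nat \<times> nat \<Rightarrow> 'n site set" where
  "block = (\<lambda>(i, k). initial_sites (N i (Suc k)) - initial_sites i)"

text \<open>The first increment is \<open>f i\<close> at a truncated configuration, of which there
  are finitely many. Later ones are controlled by two successive approximation errors.\<close>

definition bound :: "nat \<times> nat \<Rightarrow> real" where
  "bound = (\<lambda>(i, k). if k = 0 then Max ((\<lambda>x. \<bar>f i x\<bar>) ` conf (initial_sites (N i 1))) else 2 * (1/2) ^ k)"

lemma mem_block: "s \<in> block (i, k) \<longleftrightarrow> i \<le> site_index s \<and> site_index s < N i (Suc k)"
  by (auto simp: block_def initial_sites_def)

lemma N_ge: "i \<le> N i k"
  using strict_mono_leD[OF N_mono, of 0 k i] by (simp add: N_0)

lemma increment_cong:
  assumes "\<And>s. s \<in> block (i, k) \<Longrightarrow> \<omega> s = \<omega>' s"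
  shows "increment (i, k) \<omega> = increment (i, k) \<omega>'"
proof -
  have "f i (restrict \<omega> (initial_sites n)) = f i (restrict \<omega>' (initial_sites n))" if "n \<le> N i (Suc k)" for n
    using that by (intro f_local) (auto simp: restrict_def initial_sites_def mem_block intro!: assms)
  moreover have "N i k \<le> N i (Suc k)" using strict_mono_leD[OF N_mono] by simp
  ultimately show ?thesis by (simp add: increment_def)
qed

lemma increment_bound: "\<bar>increment (i, k) \<omega>\<bar> \<le> bound (i, k)"
proof (cases "k = 0")
  case True
  have "\<bar>f i (restrict \<omega> (initial_sites (N i 1)))\<bar> \<le> Max ((\<lambda>x. \<bar>f i x\<bar>) ` conf (initial_sites (N i 1)))"
    by (intro Max_ge finite_imageI finite_conf finite_initial_sites imageI restrict_in_conf)
  then show ?thesis by (simp add: True increment_def bound_def N_0 f_vacuum)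
next
  case False
  have "\<bar>f i \<omega> - f i (restrict \<omega> (initial_sites (N i (Suc k))))\<bar> \<le> (1/2) ^ Suc k"
    "\<bar>f i \<omega> - f i (restrict \<omega> (initial_sites (N i k)))\<bar> \<le> (1/2) ^ k"
    using False by (intro f_approx; simp)+
  moreover have "(1/2 :: real) ^ Suc k \<le> (1/2) ^ k" by simp
  ultimately have "\<bar>f i (restrict \<omega> (initial_sites (N i (Suc k)))) - f i (restrict \<omega> (initial_sites (N i k)))\<bar>
      \<le> 2 * (1/2) ^ k" by linarith
  then show ?thesis using False by (simp add: increment_def bound_def)
qed

lemma bound_nonneg: "bound p \<ge> 0"
  using increment_bound[of "fst p" "snd p" undefined] by simp

lemma summable_bound: "summable (\<lambda>k. bound (i, k))"
proof -
  have "summable (\<lambda>k. 2 * (1/2 :: real) ^ k)"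
    by (intro summable_mult summable_geometric) simp
  then show ?thesis
    by (subst summable_iff_shift[of _ 1, symmetric], subst (asm) summable_iff_shift[of _ 1, symmetric])
      (simp add: bound_def)
qed

text \<open>The telescoping series runs from 0 at level 0 to the limit \<open>f i \<omega>\<close>
  of the truncations. Absolute summability turns it into an unordered sum.\<close>

lemma increment_has_sum: "((\<lambda>k. increment (i, k) \<omega>) has_sum f i \<omega>) UNIV"
proof (rule norm_summable_imp_has_sum)
  show "summable (\<lambda>k. norm (increment (i, k) \<omega>))"
    by (rule summable_comparison_test_ev[OF _ summable_bound[of i]])
      (simp add: increment_bound)
  let ?a = "\<lambda>k. f i (restrict \<omega> (initial_sites (N i k)))"
  have "(\<lambda>k. ?a k - f i \<omega>) \<longlonglongrightarrow> 0"
  proof (rule Lim_null_comparison)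
    show "\<forall>\<^sub>F k in sequentially. norm (?a k - f i \<omega>) \<le> (1/2) ^ k"
      using eventually_gt_at_top[of 0]
      by eventually_elim (simp add: f_approx abs_minus_commute)
  qed (simp add: LIMSEQ_realpow_zero)
  then have "?a \<longlonglongrightarrow> f i \<omega>" by (simp add: LIM_zero_iff)
  from telescope_sums[OF this]
  show "(\<lambda>k. increment (i, k) \<omega>) sums f i \<omega>"
    by (simp add: increment_def N_0 f_vacuum)
qed

text \<open>A block determines its first index \<open>i\<close>, and its end
  \<open>N i (Suc k)\<close> then determines \<open>k\<close>, because the levels increase
  strictly.\<close>

lemma inj_block: "inj block"
proof (rule injI)
  fix p q assume eq: "block p = block q"
  obtain i k j l where p: "p = (i, k)" and q: "q = (j, l)" by (cases p; cases q)
  have index: "\<exists>s :: 'n site. site_index s = n" for n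
    using bij_is_surj[OF bij_site_index] by (metis surjD)
  have less: "n < N n (Suc m)" for n m
    using strict_monoD[OF N_mono, of 0 "Suc m" n] by (simp add: N_0)
  obtain s t :: "'n site" where "site_index s = i" "site_index t = j" using index by metis
  then have "s \<in> block (j, l)" "t \<in> block (i, k)"
    using less eq unfolding p q by (simp_all add: mem_block set_eq_iff) (metis order_refl)+
  then have "i = j" using \<open>site_index s = i\<close> \<open>site_index t = j\<close> by (simp add: mem_block)
  \<comment> \<open>Otherwise the site of index \<open>N i (Suc k)\<close> would lie in the longer
    block only.\<close>
  have "\<not> N i (Suc k) < N i (Suc l)" if "block (i, k) = block (i, l)" for k l
  proof
    assume *: "N i (Suc k) < N i (Suc l)"
    obtain s :: "'n site" where "site_index s = N i (Suc k)" using index by blast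
    then have "s \<in> block (i, l)" "s \<notin> block (i, k)" using * N_ge by (auto simp: mem_block)
    then show False using that by simp
  qed
  from this[of k l] this[of l k] have "N i (Suc k) = N i (Suc l)"
    using eq unfolding p q \<open>i = j\<close> by auto
  then have "k = l" using strict_mono_eq[OF N_mono] by simp
  then show "p = q" by (simp add: p q \<open>i = j\<close>)
qed

text \<open>
  By \<open>inj_block\<close> every support carries at most one increment.  The minus sign is that of the
  energy in the Boltzmann weight.
\<close>

definition potential :: "('n, 'a) potential" where
  "potential A x = ereal (if A \<in> range block then - increment (inv block A) x else 0)"

definition potential_bound :: "'n site set \<Rightarrow> real" where
  "potential_bound A = (if A \<in> range block then bound (inv block A) else 0)"

abbreviation term_of :: "('n site \<Rightarrow> 'a) \<Rightarrow> 'n site set \<Rightarrow> real" where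
  "term_of \<omega> A \<equiv> real_of_ereal (potential A (restrict \<omega> A))"

lemma term_of_block: "term_of \<omega> (block p) = - increment p \<omega>"
proof -
  obtain i k where p: "p = (i, k)" by (cases p)
  have "increment p (restrict \<omega> (block p)) = increment p \<omega>"
    unfolding p by (rule increment_cong) simp
  then show ?thesis by (simp add: potential_def inv_f_f[OF inj_block])
qed

lemma potential_bound_block: "potential_bound (block p) = bound p"
  by (simp add: potential_bound_def inv_f_f[OF inj_block])

lemma abs_potential_le: "\<bar>real_of_ereal (potential A x)\<bar> \<le> potential_bound A"
  by (cases "inv block A") (use increment_bound in \<open>auto simp: potential_def potential_bound_def\<close>)

text \<open>A block contains its first site, so it meets an initial segment exactly when it starts
  there. Hence only finitely many \<open>i\<close> contribute to the energy in a finite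
  volume.\<close>

lemma block_touching_initial_sites:
  "block (i, k) \<in> touching (initial_sites n) \<longleftrightarrow> i < n"
proof -
  obtain s :: "'n site" where s: "site_index s = i"
    using bij_is_surj[OF bij_site_index] by (metis surjD)
  have "i < N i (Suc k)"
    using strict_monoD[OF N_mono, of 0 "Suc k" i] by (simp add: N_0)
  with s have "s \<in> block (i, k)" by (simp add: mem_block)
  moreover have "finite (block (i, k))" by (simp add: block_def finite_initial_sites)
  ultimately have "block (i, k) \<in> touching (initial_sites n)" if "i < n"
    using that s by (auto simp: touching_def initial_sites_def)
  moreover have "i < n" if "block (i, k) \<in> touching (initial_sites n)"
    using that by (force simp: touching_def initial_sites_def mem_block)
  ultimately show ?thesis by blast
qed

text \<open>Supports that are not blocks contribute 0; the others are reindexed along the injective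
  \<open>block\<close>.\<close>

lemma has_sum_touching_initial_sites:
  fixes h :: "'n site set \<Rightarrow> real"
  assumes "\<And>A. A \<notin> range block \<Longrightarrow> h A = 0"
  shows "(h has_sum S) (touching (initial_sites n)) \<longleftrightarrow> ((\<lambda>p. h (block p)) has_sum S) ({..<n} \<times> UNIV)"
proof -
  have "(h has_sum S) (touching (initial_sites n)) \<longleftrightarrow> (h has_sum S) (block ` ({..<n} \<times> UNIV))"
  proof (rule has_sum_cong_neutral)
    fix A assume "A \<in> block ` ({..<n} \<times> UNIV) - touching (initial_sites n)"
    then show "h A = 0" using block_touching_initial_sites by auto
  next
    fix A assume A: "A \<in> touching (initial_sites n) - block ` ({..<n} \<times> UNIV)"
    show "h A = 0"
    proof (rule assms, rule notI)
      assume "A \<in> range block"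
      then obtain i k where "A = block (i, k)" by auto
      then show False using A block_touching_initial_sites[of i k n] by auto
    qed
  qed simp
  also have "\<dots> \<longleftrightarrow> ((h \<circ> block) has_sum S) ({..<n} \<times> UNIV)"
    by (intro has_sum_reindex inj_on_subset[OF inj_block]) simp
  finally show ?thesis by (simp add: o_def)
qed

lemma summable_bound_strip: "bound summable_on ({..<n} \<times> UNIV)"
proof (rule summable_on_SigmaI)
  fix i
  have "(\<lambda>k. bound (i, k)) summable_on UNIV"
    using summable_bound bound_nonneg by (simp add: summable_on_UNIV_nonneg_real_iff)
  then show "((\<lambda>k. bound (i, k)) has_sum (\<Sum>\<^sub>\<infinity>k. bound (i, k))) UNIV" by simp
qed (simp_all add: bound_nonneg)

lemma summable_potential_bound:
  assumes "finite \<Lambda>"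
  shows "potential_bound summable_on touching \<Lambda>"
proof -
  obtain n where n: "\<Lambda> \<subseteq> initial_sites n" using finite_subset_initial_sites[OF assms] by blast
  have "potential_bound summable_on touching (initial_sites n)"
  proof -
    have zero: "\<And>A. A \<notin> range block \<Longrightarrow> potential_bound A = 0"
      by (simp add: potential_bound_def)
    show ?thesis
      using summable_bound_strip[of n]
      by (simp add: summable_on_def has_sum_touching_initial_sites zero potential_bound_block)
  qed
  moreover have "touching \<Lambda> \<subseteq> touching (initial_sites n)" using n by (auto simp: touching_def)
  ultimately show ?thesis by (rule summable_on_subset_banach)
qed

lemma summable_term_of:
  assumes "finite \<Lambda>"
  shows "term_of \<omega> summable_on touching \<Lambda>"
  by (rule abs_summable_summable, rule Infinite_Sum.abs_summable_on_comparison_test'[OF summable_potential_bound[OF assms]])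
    (simp only: real_norm_def abs_potential_le)

text \<open>Summing over \<open>k\<close> first recovers each \<open>f i\<close>. Absolute
  summability on the strip justifies this order of summation.\<close>

lemma term_of_has_sum:
  "(term_of \<omega> has_sum - (\<Sum>i<n. f i \<omega>)) (touching (initial_sites n))"
proof -
  have "((\<lambda>p. increment p \<omega>) has_sum (\<Sum>i<n. f i \<omega>)) ({..<n} \<times> UNIV)"
  proof (rule has_sum_SigmaI)
    show "((\<lambda>k. increment (i, k) \<omega>) has_sum f i \<omega>) UNIV" for i by (rule increment_has_sum)
    show "(f' has_sum sum f' {..<n}) {..<n}" for f' :: "nat \<Rightarrow> real" by (rule has_sum_finite) simp
    have "norm (increment p \<omega>) \<le> bound p" for p by (cases p) (simp add: increment_bound)
    then show "(\<lambda>p. increment p \<omega>) summable_on {..<n} \<times> UNIV"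
      by (intro abs_summable_summable[OF Infinite_Sum.abs_summable_on_comparison_test'[OF summable_bound_strip]])
  qed
  then have "((\<lambda>p. term_of \<omega> (block p)) has_sum - (\<Sum>i<n. f i \<omega>)) ({..<n} \<times> UNIV)"
    unfolding term_of_block by (rule has_sum_uminusI)
  then show ?thesis
    by (subst has_sum_touching_initial_sites) (simp_all add: potential_def)
qed

lemma uniformly_convergent_potential: "uniformly_convergent_potential potential"
  by (rule uniformly_convergent_potentialI[OF _ abs_potential_le summable_potential_bound])
    (simp_all add: potential_def)

text \<open>Enlarging \<open>\<Lambda>\<close> to an initial segment makes the sum explicit. The
  added supports miss \<open>\<Lambda>\<close>, so their terms see only \<open>z\<close> and cancel
  in the difference.\<close>

lemma energy_diff:
  assumes \<Lambda>: "finite \<Lambda>" "\<Lambda> \<subseteq> initial_sites n"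
  shows "energy potential \<Lambda> z x - energy potential \<Lambda> z y =
    (\<Sum>i<n. f i (glue \<Lambda> y z)) - (\<Sum>i<n. f i (glue \<Lambda> x z))"
proof -
  let ?V = "touching (initial_sites n) :: 'n site set set"
  let ?R = "?V - touching \<Lambda>"
  have sub: "touching \<Lambda> \<subseteq> ?V" using \<Lambda> by (auto simp: touching_def)
  have split: "energy potential \<Lambda> z x = - (\<Sum>i<n. f i (glue \<Lambda> x z)) - infsum (term_of (glue \<Lambda> x z)) ?R" for x
  proof -
    let ?\<omega> = "glue \<Lambda> x z"
    have "infsum (term_of ?\<omega>) (touching \<Lambda> \<union> ?R) = infsum (term_of ?\<omega>) (touching \<Lambda>) + infsum (term_of ?\<omega>) ?R"
      by (intro infsum_Un_disjoint summable_term_of \<Lambda>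
          summable_on_subset_banach[OF summable_term_of[OF finite_initial_sites]]) auto
    moreover have "touching \<Lambda> \<union> ?R = ?V" using sub by auto
    moreover have "energy potential \<Lambda> z x = infsum (term_of ?\<omega>) (touching \<Lambda>)"
      by (intro energy_eq_infsum_touching summable_term_of \<Lambda>)
    ultimately show ?thesis using infsumI[OF term_of_has_sum[of ?\<omega> n]] by simp
  qed
  have "infsum (term_of (glue \<Lambda> x z)) ?R = infsum (term_of (glue \<Lambda> y z)) ?R"
  proof (rule infsum_cong)
    fix A assume "A \<in> ?R"
    then have "A \<inter> \<Lambda> = {}" by (auto simp: touching_def)
    then have "restrict (glue \<Lambda> x z) A = restrict (glue \<Lambda> y z) A"
      by (intro ext) (auto simp: merge_def restrict_def)
    then show "term_of (glue \<Lambda> x z) A = term_of (glue \<Lambda> y z) A" by simp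
  qed
  then show ?thesis using split[of x] split[of y] by simp
qed

end

section \<open>From logarithmic ratios to the Gibbsian specification\<close>

text \<open>The potential reproduces the limiting logarithmic ratios of the probabilities of any two
  \<open>x\<close>, \<open>y\<close> on \<open>\<Lambda>\<close> under the same boundary condition;
  normalization then gives the specification.\<close>

lemma strictly_positive_nonnull_imp_gibbs:
  fixes P :: "('n::finite site \<Rightarrow> 'a::finite) measure"
  assumes rf: "random_field P" and sp: "strictly_positive P"
    and nn: "uniformly_nonnull_limits (one_point_fin_cond P)"
  shows "gibbs_random_field P"
proof -
  have "\<forall>i. \<exists>f. uniform_limit UNIV (log_prob_step P i) f (finite_subsets_at_top UNIV)"
    using uniform_limit_log_prob_step[OF assms] by blast
  from choice[OF this]
  obtain f where f: "\<And>i. uniform_limit UNIV (log_prob_step P i) (f i) (finite_subsets_at_top UNIV)"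
    by blast
  have "\<forall>i. \<exists>N. N 0 = i \<and> strict_mono N \<and>
      (\<forall>k>0. \<forall>\<omega>. \<bar>f i \<omega> - f i (restrict \<omega> (initial_sites (N k)))\<bar> \<le> (1/2) ^ k)"
  proof
    fix i
    show "\<exists>N. N 0 = i \<and> strict_mono N \<and>
        (\<forall>k>0. \<forall>\<omega>. \<bar>f i \<omega> - f i (restrict \<omega> (initial_sites (N k)))\<bar> \<le> (1/2) ^ k)"
      by (rule fast_approximation_levels[where a = "\<lambda>m \<omega>. f i \<omega> - f i (restrict \<omega> (initial_sites m))",
            OF log_prob_step_limit_approx[OF f]])
  qed
  from choice[OF this] obtain N where N: "\<And>i. N i 0 = i" "\<And>i. strict_mono (N i)"
    "\<And>i k \<omega>. k > 0 \<Longrightarrow> \<bar>f i \<omega> - f i (restrict \<omega> (initial_sites (N i k)))\<bar> \<le> (1/2) ^ k"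
    by blast
  interpret telescoping_potential f N
  proof
    show "f i \<omega> = f i \<omega>'" if "\<And>s. i \<le> site_index s \<Longrightarrow> \<omega> s = \<omega>' s" for i \<omega> \<omega>'
      using that by (rule log_prob_step_limit_local[OF f])
  qed (use N log_prob_step_limit_vacuum[OF f] in auto)
  have pos: "cyl_prob P \<Delta> \<omega> > 0" if "finite \<Delta>" for \<Delta> \<omega>
    using sp that by (simp add: strictly_positive_iff_cyl_prob[OF rf])
  \<comment> \<open>Convergence is shown for every boundary condition \<open>z\<close>, which is
    stronger than the almost sure statement in the definition of a version.\<close>
  have lim: "((\<lambda>\<Delta>. fin_cond P \<Lambda> \<Delta> (restrict z \<Delta>) x) \<longlongrightarrow> gibbs_specification potential \<Lambda> z x)
      (finite_subsets_at_top (- \<Lambda>))" if \<Lambda>: "finite \<Lambda>" for \<Lambda> z x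
  proof -
    let ?E = "energy potential \<Lambda> z"
    let ?w = "\<lambda>y. glue \<Lambda> y z"
    obtain n where n: "\<Lambda> \<subseteq> initial_sites n" using finite_subset_initial_sites[OF \<Lambda>] by blast
    have ratio: "((\<lambda>\<Delta>. log_prob P (\<Lambda> \<union> \<Delta>) (?w y) - log_prob P (\<Lambda> \<union> \<Delta>) (?w x)) \<longlongrightarrow> ?E x - ?E y)
        (finite_subsets_at_top (- \<Lambda>))" for y
    proof -
      have step: "((\<lambda>\<Delta>. log_prob_step P i \<Delta> \<omega>) \<longlongrightarrow> f i \<omega>) (finite_subsets_at_top UNIV)" for i \<omega>
        by (rule tendsto_uniform_limitI[OF f]) simp
      have "((\<lambda>\<Delta>. (\<Sum>i<n. log_prob_step P i \<Delta> (?w y)) - (\<Sum>i<n. log_prob_step P i \<Delta> (?w x))) \<longlongrightarrow>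
          (\<Sum>i<n. f i (?w y)) - (\<Sum>i<n. f i (?w x))) (finite_subsets_at_top UNIV)"
        by (intro tendsto_diff tendsto_sum step)
      \<comment> \<open>As \<open>\<Lambda>\<close> lies in \<open>initial_sites n\<close>, both
        configurations become equal after \<open>n\<close> steps, and the remainders of the two
        telescoping sums cancel.\<close>
      moreover have "restrict (?w y) (- initial_sites n) = restrict (?w x) (- initial_sites n)"
        using n by (intro ext) (auto simp: merge_def)
      ultimately have "((\<lambda>\<Delta>. log_prob P \<Delta> (?w y) - log_prob P \<Delta> (?w x)) \<longlongrightarrow>
          (\<Sum>i<n. f i (?w y)) - (\<Sum>i<n. f i (?w x))) (finite_subsets_at_top UNIV)"
        by (simp add: sum_log_prob_step)
      from filterlim_compose[OF this filterlim_Un_finite_subsets_at_top[OF \<Lambda>]]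
      show ?thesis by (simp add: energy_diff[OF \<Lambda> n])
    qed
    have sum_pos': "(\<Sum>y\<in>conf \<Lambda>. exp (g y)) > 0" for g :: "('n site \<Rightarrow> 'a) \<Rightarrow> real"
      by (intro sum_pos finite_conf conf_nonempty \<Lambda>) simp
    \<comment> \<open>A probability is the reciprocal of the sum over \<open>y\<close> of the ratios
      of the weight of \<open>y\<close> to that of \<open>x\<close>. Both sides are written in this
      form, so only ratios need to converge.\<close>
    have "((\<lambda>\<Delta>. 1 / (\<Sum>y\<in>conf \<Lambda>. exp (log_prob P (\<Lambda> \<union> \<Delta>) (?w y) - log_prob P (\<Lambda> \<union> \<Delta>) (?w x)))) \<longlongrightarrow>
        1 / (\<Sum>y\<in>conf \<Lambda>. exp (?E x - ?E y))) (finite_subsets_at_top (- \<Lambda>))"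
      using sum_pos'[of "\<lambda>y. ?E x - ?E y"]
      by (intro tendsto_divide tendsto_const tendsto_sum tendsto_exp ratio) simp
    moreover have "1 / (\<Sum>y\<in>conf \<Lambda>. exp (?E x - ?E y)) = gibbs_specification potential \<Lambda> z x"
    proof -
      have "(\<Sum>y\<in>conf \<Lambda>. exp (?E x - ?E y)) = exp (?E x) * (\<Sum>y\<in>conf \<Lambda>. exp (- ?E y))"
        by (simp add: sum_distrib_left flip: exp_add)
      then show ?thesis by (simp add: gibbs_specification_def exp_minus divide_inverse)
    qed
    moreover have "\<forall>\<^sub>F \<Delta> in finite_subsets_at_top (- \<Lambda>).
        1 / (\<Sum>y\<in>conf \<Lambda>. exp (log_prob P (\<Lambda> \<union> \<Delta>) (?w y) - log_prob P (\<Lambda> \<union> \<Delta>) (?w x))) =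
        fin_cond P \<Lambda> \<Delta> (restrict z \<Delta>) x"
    proof (rule eventually_finite_subsets_at_top_weakI)
      fix \<Delta> assume \<Delta>: "finite \<Delta>" "\<Delta> \<subseteq> - \<Lambda>"
      then have disj: "\<Lambda> \<inter> \<Delta> = {}" by auto
      have exp_eq: "exp (log_prob P (\<Lambda> \<union> \<Delta>) (?w y) - log_prob P (\<Lambda> \<union> \<Delta>) (?w x)) =
          cyl_prob P (\<Lambda> \<union> \<Delta>) (?w y) / cyl_prob P (\<Lambda> \<union> \<Delta>) (?w x)" for y
        unfolding log_prob_def exp_diff using pos \<Lambda> \<Delta>(1) by simp
      show "1 / (\<Sum>y\<in>conf \<Lambda>. exp (log_prob P (\<Lambda> \<union> \<Delta>) (?w y) - log_prob P (\<Lambda> \<union> \<Delta>) (?w x))) =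
          fin_cond P \<Lambda> \<Delta> (restrict z \<Delta>) x"
        unfolding exp_eq fin_cond_eq_cyl_prob[OF rf \<Lambda> \<Delta>(1) disj] cyl_prob_sum[OF rf \<Lambda> \<Delta>(1) disj]
        by (simp flip: sum_divide_distrib)
    qed
    ultimately show ?thesis by (auto elim: Lim_transform_eventually)
  qed
  have "version_of_cond_distr P (gibbs_specification potential)"
    unfolding version_of_cond_distr_def
  proof (intro ballI conjI AE_I2)
    fix \<Lambda> :: "'n site set" assume "\<Lambda> \<in> fin_subsets UNIV"
    then have \<Lambda>: "finite \<Lambda>" by (simp add: fin_subsets_def)
    show "0 \<le> gibbs_specification potential \<Lambda> z x" for z x
      using gibbs_specification_pos[OF \<Lambda>, of potential z x] by simp
    show "(\<Sum>x\<in>conf \<Lambda>. gibbs_specification potential \<Lambda> z x) = 1" for z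
      unfolding gibbs_specification_def by (rule sum_normalized_eq_1[OF \<Lambda>]) simp
    show "((\<lambda>\<Delta>. fin_cond P \<Lambda> \<Delta> (restrict z \<Delta>) x) \<longlongrightarrow> gibbs_specification potential \<Lambda> z x)
        (finite_subsets_at_top (- \<Lambda>))" for z x
      by (rule lim[OF \<Lambda>])
  qed
  with uniformly_convergent_potential rf show ?thesis
    unfolding gibbs_random_field_def by blast
qed

theorem mainTheorem1:
  fixes P :: "('n::finite site \<Rightarrow> 'a::finite) measure"
  assumes "random_field P"
  shows "(gibbs_random_field P \<longleftrightarrow>
            strictly_positive P \<and> uniformly_nonnull_limits (one_point_fin_cond P)) \<and>
         (gibbs_random_field P \<longleftrightarrow>
            strictly_positive P \<and> positive_limits (one_point_fin_cond P)) \<and>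
         (strictly_positive P \<longrightarrow>
            (uniformly_nonnull_limits (one_point_fin_cond P) \<longleftrightarrow>
             positive_limits (one_point_fin_cond P)))"
proof -
  \<comment> \<open>The implications close up: Gibbsian fields have positive limits, these are
    uniformly nonnull by compactness, and uniform nonnullness yields the potential.\<close>
  have gibbs: "gibbs_random_field P \<longleftrightarrow>
      strictly_positive P \<and> uniformly_nonnull_limits (one_point_fin_cond P)"
    using gibbs_imp_strictly_positive_and_positive_limits[of P]
      strictly_positive_nonnull_imp_gibbs[OF assms] uniformly_nonnull_limits_iff_positive_limits
    by blast
  then show ?thesis by (simp add: uniformly_nonnull_limits_iff_positive_limits)
qed

end
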